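(* Let $\mathcal{G}$ be a non-complete decomposable graph, $\mathcal{P}=(C_1,\ldots,C_r)$ a perfect order of its cliques with separators $S_2,\ldots,S_r$, and $\mathcal{D}$ a DAG version of $\mathcal{G}$ induced by $\mathcal{P}$ such that $S_2$ is ancestral in $\mathcal{D}$. Then the set of $(\alpha,\beta)\in\mathbb{R}^r\times\mathbb{R}^{r-1}$ satisfying $$\int_{\mathrm{Q}_{\mathcal{G}}}\omega_{\mathrm{Q}_{\mathcal{G}}}(\alpha,\beta,U^E,d\Sigma^E)<\infty\quad\text{for every }U^E\in\mathrm{Q}_{\mathcal{G}}$$ has dimension greater than or equal to $r+r_{\mathcal{D}}$ (i.e. it contains a submanifold of $\mathbb{R}^r\times\mathbb{R}^{r-1}$ of dimension at least $r+r_{\mathcal{D}}$), where $r_{\mathcal{D}}$ is the number of distinct separators of $\mathcal{G}$ that are ancestral in $\mathcal{D}$.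
   Context: Let $\mathcal{G}=(V,E)$ be a decomposable (chordal) undirected graph, $V=\{1,\ldots,p\}$; all loops are regarded as belonging to $E$. "Clique" means maximal complete vertex set. A perfect order of the cliques is an enumeration $\mathcal{P}=(C_1,\ldots,C_r)$ of all cliques such that, with $H_j=C_1\cup\cdots\cup C_j$, each separator $S_j=H_{j-1}\cap C_j$ ($2\le j\le r$) is contained in some $C_i$, $i<j$. Put $c_j=|C_j|$, $s_j=|S_j|$. A DAG version of $\mathcal{G}$ is an acyclic directed graph $\mathcal{D}$ whose underlying undirected graph is $\mathcal{G}$. A set $A\subseteq V$ is ancestral in $\mathcal{D}$ if it contains the parents of all its members. $\mathcal{D}$ is induced by $\mathcal{P}$ if $H_1,\ldots,H_{r-1}$ are all ancestral in $\mathcal{D}$. $\mathrm{PD}_{\mathcal{G}}$ is the set of positive definite $p\times p$ matrices $\Sigma$ with $(\Sigma^{-1})_{ij}=0$ whenever $\{i,j\}\notin E$. $\mathrm{Q}_{\mathcal{G}}$ is the set of symmetric incomplete matrices $(\Gamma_{ij})_{\{i,j\}\in E}$ with $\Gamma_C$ positive definite for each clique $C$. Each $\Sigma^E\in\mathrm{Q}_{\mathcal{G}}$ has a unique completion $\Sigma\in\mathrm{PD}_{\mathcal{G}}$ agreeing with it on $E$. For $\alpha\in\mathbb{R}^r$, $\beta=(\beta_2,\ldots,\beta_r)\in\mathbb{R}^{r-1}$ let $H_{\mathcal{G}}(\alpha,\beta,\Sigma^E)=\prod_{i=1}^r\det(\Sigma_{C_i})^{\alpha_i}/\prod_{i=2}^r\det(\Sigma_{S_i})^{\beta_i}$.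 Let $\mu_{\mathcal{G}}(d\Sigma^E)=H_{\mathcal{G}}(-\tfrac{c+1}{2},-\tfrac{s+1}{2},\Sigma^E)\,d\Sigma^E$ with $c=(c_1,\ldots,c_r)$, $s=(s_2,\ldots,s_r)$, and $d\Sigma^E$ Lebesgue measure on $\mathrm{Q}_{\mathcal{G}}$. For $U^E\in\mathrm{Q}_{\mathcal{G}}$ with completion $U\in\mathrm{PD}_{\mathcal{G}}$, $$\omega_{\mathrm{Q}_{\mathcal{G}}}(\alpha,\beta,U^E,d\Sigma^E)=e^{-\mathrm{tr}(\Sigma U^{-1})}H_{\mathcal{G}}(\alpha,\beta,\Sigma^E)\,\mu_{\mathcal{G}}(d\Sigma^E).$$ *)

theory Defs
  imports "HOL-Analysis.Analysis"
begin

section \<open>Decomposable graphs, perfect orders and DAG versions\<close>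

text \<open>A graph on the finite vertex type \<open>'v\<close> is its set of edges \<open>{i, j}\<close>; all loops
  \<open>{i} = {i, i}\<close> belong to it.\<close>

definition undirected_graph :: "'v set set \<Rightarrow> bool" where
  "undirected_graph E \<longleftrightarrow> (\<forall>e\<in>E. \<exists>i j. e = {i, j}) \<and> (\<forall>i. {i} \<in> E)"

definition complete_in :: "'v set set \<Rightarrow> 'v set \<Rightarrow> bool" where
  "complete_in E A \<longleftrightarrow> (\<forall>i\<in>A. \<forall>j\<in>A. {i, j} \<in> E)"

definition clique :: "'v set set \<Rightarrow> 'v set \<Rightarrow> bool" where
  "clique E A \<longleftrightarrow> complete_in E A \<and> (\<forall>B. complete_in E B \<longrightarrow> A \<subseteq> B \<longrightarrow> B = A)"

definition graph_cycle :: "'v set set \<Rightarrow> 'v list \<Rightarrow> bool" where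
  "graph_cycle E vs \<longleftrightarrow> length vs \<ge> 3 \<and> distinct vs \<and>
     (\<forall>k<length vs. {vs ! k, vs ! (Suc k mod length vs)} \<in> E)"

definition has_chord :: "'v set set \<Rightarrow> 'v list \<Rightarrow> bool" where
  "has_chord E vs \<longleftrightarrow> (\<exists>k<length vs. \<exists>l<length vs.
     k \<noteq> l \<and> l \<noteq> Suc k mod length vs \<and> k \<noteq> Suc l mod length vs \<and> {vs ! k, vs ! l} \<in> E)"

definition decomposable :: "'v set set \<Rightarrow> bool" where
  "decomposable E \<longleftrightarrow> undirected_graph E \<and>
     (\<forall>vs. graph_cycle E vs \<and> length vs \<ge> 4 \<longrightarrow> has_chord E vs)"

text \<open>An order of the cliques is a function \<open>C\<close> on the positions \<open>{1..r}\<close>; its values at other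
  positions are irrelevant. The separators are \<open>sep C j\<close> for \<open>j \<in> {2..r}\<close>.\<close>

definition hist :: "(nat \<Rightarrow> 'v set) \<Rightarrow> nat \<Rightarrow> 'v set" where
  "hist C j = (\<Union>i\<in>{1..j}. C i)"

definition sep :: "(nat \<Rightarrow> 'v set) \<Rightarrow> nat \<Rightarrow> 'v set" where
  "sep C j = hist C (j - 1) \<inter> C j"

definition perfect_order :: "'v set set \<Rightarrow> nat \<Rightarrow> (nat \<Rightarrow> 'v set) \<Rightarrow> bool" where
  "perfect_order E r C \<longleftrightarrow> bij_betw C {1..r} {A. clique E A} \<and>
     (\<forall>j\<in>{2..r}. \<exists>i\<in>{1..<j}. sep C j \<subseteq> C i)"

text \<open>\<open>(i, j) \<in> D\<close> is the arrow \<open>i \<rightarrow> j\<close>, i.e. \<open>i\<close> is a parent of \<open>j\<close>.\<close>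

definition dag_version :: "'v set set \<Rightarrow> 'v rel \<Rightarrow> bool" where
  "dag_version E D \<longleftrightarrow> acyclic D \<and>
     (\<forall>i j. i \<noteq> j \<longrightarrow> ({i, j} \<in> E \<longleftrightarrow> (i, j) \<in> D \<or> (j, i) \<in> D))"

definition ancestral :: "'v rel \<Rightarrow> 'v set \<Rightarrow> bool" where
  "ancestral D A \<longleftrightarrow> (\<forall>j\<in>A. \<forall>i. (i, j) \<in> D \<longrightarrow> i \<in> A)"

definition induced_by :: "'v rel \<Rightarrow> nat \<Rightarrow> (nat \<Rightarrow> 'v set) \<Rightarrow> bool" where
  "induced_by D r C \<longleftrightarrow> (\<forall>j\<in>{1..r - 1}. ancestral D (hist C j))"

definition num_ancestral_seps :: "'v rel \<Rightarrow> nat \<Rightarrow> (nat \<Rightarrow> 'v set) \<Rightarrow> nat" where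
  "num_ancestral_seps D r C = card {A \<in> sep C ` {2..r}. ancestral D A}"

section \<open>Incomplete matrices\<close>

definition pos_def_on :: "'v::finite set \<Rightarrow> ('v \<Rightarrow> 'v \<Rightarrow> real) \<Rightarrow> bool" where
  "pos_def_on A M \<longleftrightarrow> (\<forall>i\<in>A. \<forall>j\<in>A. M i j = M j i) \<and>
     (\<forall>x :: 'v \<Rightarrow> real. (\<exists>i\<in>A. x i \<noteq> 0) \<longrightarrow> (\<Sum>i\<in>A. \<Sum>j\<in>A. x i * M i j * x j) > 0)"

text \<open>The determinant of the principal submatrix indexed by \<open>A\<close>: the Leibniz sum that defines
  \<^const>\<open>det\<close>, with the index set \<open>UNIV\<close> replaced by \<open>A\<close>. It is \<open>1\<close> for \<open>A = {}\<close>.\<close>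

definition det_on :: "'v::finite set \<Rightarrow> ('v \<Rightarrow> 'v \<Rightarrow> real) \<Rightarrow> real" where
  "det_on A M = (\<Sum>p | p permutes A. of_int (sign p) * (\<Prod>i\<in>A. M i (p i)))"

lemma det_on_UNIV: "det_on UNIV (\<lambda>i j. M $ i $ j) = det M"
  by (simp add: det_on_def det_def)

lemma det_on_empty: "det_on {} M = 1"
  by (simp add: det_on_def)

definition PD_G :: "'v::finite set set \<Rightarrow> (real ^ 'v ^ 'v) set" where
  "PD_G E = {\<Sigma>. pos_def_on UNIV (\<lambda>i j. \<Sigma> $ i $ j) \<and>
     (\<forall>i j. {i, j} \<notin> E \<longrightarrow> matrix_inv \<Sigma> $ i $ j = 0)}"

text \<open>A symmetric incomplete matrix is a function on the set of edges: the entry at \<open>(i, j)\<close> is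
  \<open>\<Gamma> {i, j}\<close>, so that symmetry holds by construction and the space of all of them is
  \<open>\<real>\<^sup>E\<close>, with one coordinate for each unordered pair in \<open>E\<close>.\<close>

definition Q_G :: "'v::finite set set \<Rightarrow> ('v set \<Rightarrow> real) set" where
  "Q_G E = {\<Gamma> \<in> E \<rightarrow>\<^sub>E UNIV. \<forall>A. clique E A \<longrightarrow> pos_def_on A (\<lambda>i j. \<Gamma> {i, j})}"

definition completion :: "'v::finite set set \<Rightarrow> ('v set \<Rightarrow> real) \<Rightarrow> real ^ 'v ^ 'v" where
  "completion E \<Gamma> =
     (THE \<Sigma>. \<Sigma> \<in> PD_G E \<and> (\<forall>i j. {i, j} \<in> E \<longrightarrow> \<Sigma> $ i $ j = \<Gamma> {i, j}))"

section \<open>The measures\<close>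

definition H_G ::
  "nat \<Rightarrow> (nat \<Rightarrow> 'v::finite set) \<Rightarrow> (nat \<Rightarrow> real) \<Rightarrow> (nat \<Rightarrow> real) \<Rightarrow> ('v set \<Rightarrow> real) \<Rightarrow> real" where
  "H_G r C \<alpha> \<beta> \<Gamma> =
     (\<Prod>i=1..r. det_on (C i) (\<lambda>k l. \<Gamma> {k, l}) powr \<alpha> i) /
     (\<Prod>i=2..r. det_on (sep C i) (\<lambda>k l. \<Gamma> {k, l}) powr \<beta> i)"

definition lebesgue_Q :: "'v::finite set set \<Rightarrow> ('v set \<Rightarrow> real) measure" where
  "lebesgue_Q E = restrict_space (\<Pi>\<^sub>M e\<in>E. lborel) (Q_G E)"

definition mu_G :: "'v::finite set set \<Rightarrow> nat \<Rightarrow> (nat \<Rightarrow> 'v set) \<Rightarrow> ('v set \<Rightarrow> real) measure" where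
  "mu_G E r C = density (lebesgue_Q E) (\<lambda>\<Gamma>. ennreal
     (H_G r C (\<lambda>i. - (real (card (C i)) + 1) / 2) (\<lambda>i. - (real (card (sep C i)) + 1) / 2) \<Gamma>))"

definition omega_Q ::
  "'v::finite set set \<Rightarrow> nat \<Rightarrow> (nat \<Rightarrow> 'v set) \<Rightarrow> (nat \<Rightarrow> real) \<Rightarrow> (nat \<Rightarrow> real) \<Rightarrow>
     ('v set \<Rightarrow> real) \<Rightarrow> ('v set \<Rightarrow> real) measure" where
  "omega_Q E r C \<alpha> \<beta> U = density (mu_G E r C) (\<lambda>\<Gamma>. ennreal
     (exp (- trace (completion E \<Gamma> ** matrix_inv (completion E U))) * H_G r C \<alpha> \<beta> \<Gamma>))"

section \<open>Smooth submanifolds of a Euclidean space\<close>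

text \<open>These are used for open \<open>S\<close> only; \<open>Ck_on k S f\<close> then says that all iterated directional
  derivatives of \<open>f\<close> up to order \<open>k\<close> exist as total derivatives and are continuous on \<open>S\<close>.\<close>

primrec Ck_on ::
  "nat \<Rightarrow> 'a::real_normed_vector set \<Rightarrow> ('a \<Rightarrow> 'b::real_normed_vector) \<Rightarrow> bool" where
  "Ck_on 0 S f \<longleftrightarrow> continuous_on S f"
| "Ck_on (Suc k) S f \<longleftrightarrow> (\<forall>x\<in>S. f differentiable (at x)) \<and>
     (\<forall>v. Ck_on k S (\<lambda>x. frechet_derivative f (at x) v))"

definition smooth_on ::
  "'a::real_normed_vector set \<Rightarrow> ('a \<Rightarrow> 'b::real_normed_vector) \<Rightarrow> bool" where
  "smooth_on S f \<longleftrightarrow> (\<forall>k. Ck_on k S f)"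

text \<open>A nonempty \<open>d\<close>-dimensional embedded submanifold: near each of its points some smooth
  diffeomorphism between open sets of the ambient space straightens \<open>M\<close> to a \<open>d\<close>-dimensional
  linear subspace.\<close>

definition submanifold :: "nat \<Rightarrow> 'a::euclidean_space set \<Rightarrow> bool" where
  "submanifold d M \<longleftrightarrow> M \<noteq> {} \<and>
     (\<forall>x\<in>M. \<exists>V W (\<phi> :: 'a \<Rightarrow> 'a) \<psi> L. open V \<and> x \<in> V \<and> open W \<and>
        homeomorphism V W \<phi> \<psi> \<and> smooth_on V \<phi> \<and> smooth_on W \<psi> \<and>
        subspace L \<and> dim L = d \<and> \<phi> ` (M \<inter> V) = L \<inter> W)"

end

theory Submission
  imports Defs "HOL-Probability.Distributions"
begin

text \<open>A DAG version \<open>D\<close> that is induced by a perfect order is perfect: a vertex \<open>v\<close> that is new in the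
  clique \<open>C\<^sub>j\<close> has \<open>S\<^sub>j \<subseteq> pa v \<subseteq> C\<^sub>j\<close>. Hence the coordinates of \<open>\<Sigma>\<^sup>E\<close> can be grouped by vertex, the row of \<open>v\<close>
  consisting of the entries at \<open>{v, p}\<close> for \<open>p\<close> in the family \<open>fa v = {v} \<union> pa v\<close>. Let \<open>\<sigma>\<^sub>v\<close> be the
  residual variance of \<open>v\<close> in its regression on \<open>pa v\<close>, that is,
  \<open>det \<Sigma>\<^bsub>fa v\<^esub> / det \<Sigma>\<^bsub>pa v\<^esub>\<close>.

  The exponent \<open>tr (\<Sigma> U\<^sup>-\<^sup>1)\<close> is a sum over the vertices of quadratic forms of the matrices \<open>\<Sigma>\<^bsub>fa v\<^esub>\<close>,
  because \<open>U\<^sup>-\<^sup>1\<close> is the sum of the squares of the residual forms of \<open>U\<close>, divided by its residual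
  variances (\<open>completion_properties\<close>, \<open>trace_completion\<close>). The determinant of \<open>\<Sigma>\<close> on \<open>C\<^sub>j\<close> is that
  on \<open>S\<^sub>j\<close> times the \<open>\<sigma>\<^sub>v\<close> of the new vertices \<open>v\<close>; the determinant on an ancestral \<open>S\<^sub>j\<close> is itself a product
  of such variances. If \<open>\<alpha>\<^sub>j = \<beta>\<^sub>j\<close> for every \<open>j\<close> whose separator is not ancestral, all
  determinants of the other separators cancel against the Jacobians of the regressions, and the density
  becomes a product of one factor for each vertex \<open>v\<close>, a function of \<open>\<Sigma>\<^bsub>fa v\<^esub>\<close> that contains a power
  of \<open>\<sigma>\<^sub>v\<close> (\<open>H_G_factorization\<close>, \<open>density_eq_prod_factor\<close>).

  Integrate these factors in reverse order of \<open>D\<close>. The row of a last vertex occurs in its own factor only.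
  The integral of this factor over that row is a gamma integral in \<open>\<sigma>\<^sub>v\<close> times a Gaussian integral in the
  covariances with the parents. It does not depend on the remaining entries, and it is finite if
  the exponent of \<open>\<sigma>\<^sub>v\<close> exceeds \<open>-1\<close> (\<open>nn_integral_regression\<close>, \<open>nn_integral_prod_factor_finite\<close>).

  So the integral is finite on the intersection of the linear subspace that is given by \<open>\<alpha>\<^sub>j = \<beta>\<^sub>j\<close> for the
  \<open>j\<close> with a separator that is not ancestral, and the open set on which all exponents exceed \<open>-1\<close>. Both
  contain the point whose coordinates all equal the same large number. The subspace has dimension
  \<open>r\<close> plus the number of \<open>j\<close> with an ancestral separator; distinct separators have distinct positions.\<close>

section \<open>Positive definite functions on a finite index set\<close>

lemma pos_def_on_subset:
  assumes "pos_def_on A M" "B \<subseteq> A"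
  shows "pos_def_on B M"
  unfolding pos_def_on_def
proof (intro conjI allI impI ballI)
  fix i j assume "i \<in> B" "j \<in> B"
  then show "M i j = M j i" using assms unfolding pos_def_on_def by blast
next
  fix x :: "'a \<Rightarrow> real" assume ex: "\<exists>i\<in>B. x i \<noteq> 0"
  define y where "y i = (if i \<in> B then x i else 0)" for i
  have "(\<Sum>i\<in>A. \<Sum>j\<in>A. y i * M i j * y j) = (\<Sum>i\<in>B. \<Sum>j\<in>A. y i * M i j * y j)"
    using assms(2) by (intro sum.mono_neutral_right) (auto simp: y_def)
  also have "\<dots> = (\<Sum>i\<in>B. \<Sum>j\<in>B. y i * M i j * y j)"
    using assms(2) by (intro sum.cong refl sum.mono_neutral_right) (auto simp: y_def)
  also have "\<dots> = (\<Sum>i\<in>B. \<Sum>j\<in>B. x i * M i j * x j)"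
    by (intro sum.cong refl) (simp add: y_def)
  finally have eq: "(\<Sum>i\<in>A. \<Sum>j\<in>A. y i * M i j * y j) = (\<Sum>i\<in>B. \<Sum>j\<in>B. x i * M i j * x j)" .
  have "\<exists>i\<in>A. y i \<noteq> 0" using ex assms(2) by (auto simp: y_def)
  then have "(\<Sum>i\<in>A. \<Sum>j\<in>A. y i * M i j * y j) > 0"
    using assms(1) unfolding pos_def_on_def by blast
  then show "(\<Sum>i\<in>B. \<Sum>j\<in>B. x i * M i j * x j) > 0" unfolding eq .
qed

lemma pos_def_on_cong:
  assumes "\<And>i j. i \<in> A \<Longrightarrow> j \<in> A \<Longrightarrow> M i j = N i j"
  shows "pos_def_on A M \<longleftrightarrow> pos_def_on A N"
  unfolding pos_def_on_def using assms by simp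

lemma det_on_cong:
  assumes "\<And>i j. i \<in> A \<Longrightarrow> j \<in> A \<Longrightarrow> M i j = N i j"
  shows "det_on A M = det_on A N"
  unfolding det_on_def
proof (intro sum.cong refl arg_cong2[where f = "(*)"] prod.cong)
  fix p i assume "p \<in> {p. p permutes A}" "i \<in> A"
  then show "M i (p i) = N i (p i)" using assms permutes_in_image by fastforce
qed

text \<open>Subtracting the combination of the other rows turns row \<open>a\<close> into \<open>s\<close> times a unit vector,
  so that the Leibniz sum reduces to the permutations that fix \<open>a\<close>. This is the block formula for
  the determinant with the Schur complement \<open>s\<close> of the entry at \<open>a\<close>.\<close>

lemma det_on_insert:
  fixes M :: "'v::finite \<Rightarrow> 'v \<Rightarrow> real"
  assumes a: "a \<notin> A"
    and c: "\<And>q. q \<in> A \<Longrightarrow> M a q = (\<Sum>p\<in>A. c p * M p q)"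
    and s: "s = M a a - (\<Sum>p\<in>A. c p * M p a)"
  shows "det_on (insert a A) M = s * det_on A M"
proof -
  define P where "P = {p. p permutes insert a A}"
  define F where "F R = (\<Sum>p\<in>P. of_int (sign p) * (R (p a) * (\<Prod>i\<in>A. M i (p i))))"
    for R :: "'v \<Rightarrow> real"
  have det: "det_on (insert a A) M = F (M a)"
    using a unfolding det_on_def F_def P_def by simp
  have F_cong: "F R = F R'" if "\<And>q. q \<in> insert a A \<Longrightarrow> R q = R' q" for R R'
    unfolding F_def
  proof (rule sum.cong[OF refl])
    fix p assume "p \<in> P"
    then have "p a \<in> insert a A" unfolding P_def using permutes_in_image[of p "insert a A" a] by simp
    then show "of_int (sign p) * (R (p a) * (\<Prod>i\<in>A. M i (p i))) =
      of_int (sign p) * (R' (p a) * (\<Prod>i\<in>A. M i (p i)))" using that by simp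
  qed
  have "F (M a) = F (\<lambda>q. (\<Sum>p\<in>A. c p * M p q) + (if q = a then s else 0))"
    by (rule F_cong) (use a c s in auto)
  also have "\<dots> = F (\<lambda>q. \<Sum>p\<in>A. c p * M p q) + F (\<lambda>q. if q = a then s else 0)"
    unfolding F_def by (simp add: sum.distrib[symmetric] algebra_simps)
  also have "F (\<lambda>q. \<Sum>p\<in>A. c p * M p q) = (\<Sum>p\<in>A. c p * F (M p))"
    unfolding F_def
    by (simp add: sum_distrib_left sum_distrib_right mult.assoc mult.left_commute)
      (rule sum.swap)
  also have "F (M q) = 0" if q: "q \<in> A" for q
  proof -
    have "q \<noteq> a" using a q by blast
    define t where "t = Transposition.transpose a q"
    have t: "t permutes insert a A"
      unfolding t_def using q by (simp add: permutes_swap_id)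
    have tt: "t \<circ> t = id" unfolding t_def by simp
    have "F (M q) = (\<Sum>p\<in>P. of_int (sign (p \<circ> t)) * (M q ((p \<circ> t) a) * (\<Prod>i\<in>A. M i ((p \<circ> t) i))))"
      unfolding F_def
      by (rule sum.reindex_bij_witness[where i = "\<lambda>p. p \<circ> t" and j = "\<lambda>p. p \<circ> t"])
        (auto simp: P_def permutes_compose[OF t] comp_assoc tt)
    also have "\<dots> = (\<Sum>p\<in>P. - (of_int (sign p) * (M q (p a) * (\<Prod>i\<in>A. M i (p i)))))"
    proof (rule sum.cong[OF refl])
      fix p assume "p \<in> P"
      then have "permutation p" unfolding P_def permutation_permutes by auto
      moreover have "permutation t" using t unfolding permutation_permutes by auto
      ultimately have sg: "sign (p \<circ> t) = - sign p"
        using \<open>q \<noteq> a\<close> by (simp add: sign_compose t_def sign_swap_id)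
      have "(\<Prod>i\<in>A. M i ((p \<circ> t) i)) = M q (p a) * (\<Prod>i\<in>A - {q}. M i (p i))"
      proof -
        have "(\<Prod>i\<in>A - {q}. M i ((p \<circ> t) i)) = (\<Prod>i\<in>A - {q}. M i (p i))"
          by (rule prod.cong) (use a in \<open>auto simp: t_def Transposition.transpose_def\<close>)
        then show ?thesis using q by (simp add: prod.remove t_def)
      qed
      moreover have "(\<Prod>i\<in>A. M i (p i)) = M q (p q) * (\<Prod>i\<in>A - {q}. M i (p i))"
        using q by (simp add: prod.remove)
      ultimately show "of_int (sign (p \<circ> t)) * (M q ((p \<circ> t) a) * (\<Prod>i\<in>A. M i ((p \<circ> t) i))) =
          - (of_int (sign p) * (M q (p a) * (\<Prod>i\<in>A. M i (p i))))"
        unfolding sg by (simp add: t_def)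
    qed
    also have "\<dots> = - F (M q)" unfolding F_def by (simp add: sum_negf)
    finally show ?thesis by simp
  qed
  then have "(\<Sum>p\<in>A. c p * F (M p)) = 0" by simp
  also have "F (\<lambda>q. if q = a then s else 0) = s * det_on A M"
  proof -
    have "F (\<lambda>q. if q = a then s else 0) =
      (\<Sum>p | p permutes A. of_int (sign p) * (s * (\<Prod>i\<in>A. M i (p i))))"
      unfolding F_def
    proof (rule sum.mono_neutral_cong_right)
      show "finite P" unfolding P_def by simp
      show "{p. p permutes A} \<subseteq> P" unfolding P_def by (auto intro: permutes_subset)
      show "\<forall>p\<in>P - {p. p permutes A}.
          of_int (sign p) * ((if p a = a then s else 0) * (\<Prod>i\<in>A. M i (p i))) = 0"
      proof
        fix p assume p: "p \<in> P - {p. p permutes A}"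
        have "p a \<noteq> a"
        proof
          assume "p a = a"
          then have "p permutes A"
            using p unfolding P_def by (auto intro: permutes_superset)
          then show False using p by simp
        qed
        then show "of_int (sign p) * ((if p a = a then s else 0) * (\<Prod>i\<in>A. M i (p i))) = 0"
          by simp
      qed
    qed (use a in \<open>auto simp: permutes_not_in\<close>)
    then show ?thesis unfolding det_on_def by (simp add: sum_distrib_left mult.left_commute)
  qed
  finally show ?thesis using det by simp
qed

text \<open>Completing the square in the variable of the index \<open>a\<close>.\<close>

lemma quadratic_form_insert:
  fixes M :: "'v::finite \<Rightarrow> 'v \<Rightarrow> real"
  assumes a: "a \<notin> A"
    and sym: "\<And>i j. i \<in> insert a A \<Longrightarrow> j \<in> insert a A \<Longrightarrow> M i j = M j i"
    and c: "\<And>q. q \<in> A \<Longrightarrow> (\<Sum>p\<in>A. M q p * c p) = M q a"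
    and s: "s = M a a - (\<Sum>p\<in>A. c p * M p a)"
  shows "(\<Sum>i\<in>insert a A. \<Sum>j\<in>insert a A. x i * M i j * x j) =
    (\<Sum>i\<in>A. \<Sum>j\<in>A. (x i + x a * c i) * M i j * (x j + x a * c j)) + s * (x a)\<^sup>2"
proof -
  define l where "l = (\<Sum>i\<in>A. x i * M i a)"
  define k where "k = (\<Sum>p\<in>A. c p * M p a)"
  have l1: "(\<Sum>i\<in>A. \<Sum>j\<in>A. x i * M i j * c j) = l"
    unfolding l_def using c by (intro sum.cong) (auto simp: sum_distrib_left[symmetric] mult.assoc)
  have l2: "(\<Sum>i\<in>A. \<Sum>j\<in>A. c i * M i j * x j) = l"
  proof -
    have "(\<Sum>i\<in>A. \<Sum>j\<in>A. c i * M i j * x j) = (\<Sum>j\<in>A. \<Sum>i\<in>A. c i * M i j * x j)"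
      by (rule sum.swap)
    also have "\<dots> = (\<Sum>j\<in>A. \<Sum>i\<in>A. x j * M j i * c i)"
      using sym by (intro sum.cong) (auto simp: mult_ac)
    finally show ?thesis using l1 by simp
  qed
  have k1: "(\<Sum>i\<in>A. \<Sum>j\<in>A. c i * M i j * c j) = k"
    unfolding k_def using c by (intro sum.cong) (auto simp: sum_distrib_left[symmetric] mult.assoc)
  have "(\<Sum>i\<in>A. \<Sum>j\<in>A. (x i + x a * c i) * M i j * (x j + x a * c j)) =
     (\<Sum>i\<in>A. \<Sum>j\<in>A. x i * M i j * x j + x a * (x i * M i j * c j) + x a * (c i * M i j * x j)
        + (x a)\<^sup>2 * (c i * M i j * c j))"
    by (intro sum.cong) (auto simp: algebra_simps power2_eq_square)
  also have "\<dots> = (\<Sum>i\<in>A. \<Sum>j\<in>A. x i * M i j * x j) + x a * l + x a * l + (x a)\<^sup>2 * k"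
    unfolding sum.distrib sum_distrib_left[symmetric] l1 l2 k1 ..
  finally have 1: "(\<Sum>i\<in>A. \<Sum>j\<in>A. (x i + x a * c i) * M i j * (x j + x a * c j)) =
     (\<Sum>i\<in>A. \<Sum>j\<in>A. x i * M i j * x j) + x a * l + x a * l + (x a)\<^sup>2 * k" .
  have 2: "(\<Sum>j\<in>A. x a * M a j * x j) = x a * l"
    unfolding l_def sum_distrib_left using sym by (intro sum.cong) (auto simp: mult_ac)
  have 3: "(\<Sum>i\<in>A. x i * M i a * x a) = x a * l"
    unfolding l_def sum_distrib_left by (intro sum.cong) (auto simp: mult_ac)
  have "(\<Sum>i\<in>insert a A. \<Sum>j\<in>insert a A. x i * M i j * x j) =
     x a * M a a * x a + x a * l + (x a * l + (\<Sum>i\<in>A. \<Sum>j\<in>A. x i * M i j * x j))"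
    using a by (simp add: sum.distrib 2 3)
  then show ?thesis
    unfolding s k_def[symmetric] 1 by (simp add: algebra_simps power2_eq_square)
qed

text \<open>After completing the square, the last coefficient \<open>s\<close>, the Schur complement, decides.\<close>

lemma pos_def_on_insert:
  fixes M :: "'v::finite \<Rightarrow> 'v \<Rightarrow> real"
  assumes a: "a \<notin> A"
    and sym: "\<And>i j. i \<in> insert a A \<Longrightarrow> j \<in> insert a A \<Longrightarrow> M i j = M j i"
    and pd: "pos_def_on A M"
    and c: "\<And>q. q \<in> A \<Longrightarrow> (\<Sum>p\<in>A. M q p * c p) = M q a"
    and s: "s = M a a - (\<Sum>p\<in>A. c p * M p a)"
  shows "pos_def_on (insert a A) M \<longleftrightarrow> s > 0"
proof
  note q = quadratic_form_insert[where M = M and c = c, OF a sym c s]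
  assume "pos_def_on (insert a A) M"
  define x where "x i = (if i = a then 1 else - c i)" for i
  have "(\<Sum>i\<in>insert a A. \<Sum>j\<in>insert a A. x i * M i j * x j) > 0"
    using \<open>pos_def_on (insert a A) M\<close> unfolding pos_def_on_def by (auto simp: x_def)
  moreover have "(\<Sum>i\<in>A. \<Sum>j\<in>A. (x i + x a * c i) * M i j * (x j + x a * c j)) = 0"
    using a by (intro sum.neutral ballI) (auto simp: x_def)
  ultimately show "s > 0" using q[of x] by (simp add: x_def)
next
  note q = quadratic_form_insert[where M = M and c = c, OF a sym c s]
  assume "s > 0"
  show "pos_def_on (insert a A) M"
    unfolding pos_def_on_def
  proof (intro conjI allI impI)
    show "\<forall>i\<in>insert a A. \<forall>j\<in>insert a A. M i j = M j i" using sym by blast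
    fix x :: "'v \<Rightarrow> real" assume ex: "\<exists>i\<in>insert a A. x i \<noteq> 0"
    have pos: "(\<Sum>i\<in>A. \<Sum>j\<in>A. z i * M i j * z j) > 0" if "\<exists>i\<in>A. z i \<noteq> 0" for z
      using pd that unfolding pos_def_on_def by blast
    show "(\<Sum>i\<in>insert a A. \<Sum>j\<in>insert a A. x i * M i j * x j) > 0"
    proof (cases "\<exists>i\<in>A. x i + x a * c i \<noteq> 0")
      case True
      have "s * (x a)\<^sup>2 \<ge> 0" using \<open>s > 0\<close> by simp
      then show ?thesis using q[of x] pos[OF True] by linarith
    next
      case False
      then have "x a \<noteq> 0" using ex by auto
      then have "s * (x a)\<^sup>2 > 0" using \<open>s > 0\<close> by simp
      moreover have "(\<Sum>i\<in>A. \<Sum>j\<in>A. (x i + x a * c i) * M i j * (x j + x a * c j)) = 0"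
        using False by (intro sum.neutral ballI) auto
      ultimately show ?thesis using q[of x] by simp
    qed
  qed
qed

lemma pos_def_on_solvable:
  fixes M :: "'v::finite \<Rightarrow> 'v \<Rightarrow> real"
  assumes "pos_def_on A M"
  shows "\<exists>y. \<forall>i\<in>A. (\<Sum>j\<in>A. M i j * y j) = x i"
  using finite[of A] assms
proof (induction A arbitrary: x rule: finite_induct)
  case empty
  then show ?case by simp
next
  case (insert a A)
  have sym: "\<And>i j. i \<in> insert a A \<Longrightarrow> j \<in> insert a A \<Longrightarrow> M i j = M j i"
    using insert.prems unfolding pos_def_on_def by blast
  have pd: "pos_def_on A M" using insert.prems by (rule pos_def_on_subset) auto
  obtain c where c: "\<And>q. q \<in> A \<Longrightarrow> (\<Sum>p\<in>A. M q p * c p) = M q a"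
    using insert.IH[OF pd, of "\<lambda>q. M q a"] by blast
  obtain y where y: "\<And>q. q \<in> A \<Longrightarrow> (\<Sum>p\<in>A. M q p * y p) = x q"
    using insert.IH[OF pd, of x] by blast
  define s where "s = M a a - (\<Sum>p\<in>A. c p * M p a)"
  have "s > 0"
    using pos_def_on_insert[where M = M and c = c, OF insert.hyps(2) sym pd c s_def] insert.prems by simp
  define l where "l = (x a - (\<Sum>p\<in>A. M a p * y p)) / s"
  define z where "z i = (if i = a then l else y i - l * c i)" for i
  have red: "(\<Sum>j\<in>insert a A. M i j * z j) = (\<Sum>j\<in>A. M i j * y j) - l * (\<Sum>j\<in>A. M i j * c j) + M i a * l" for i
  proof -
    have "(\<Sum>j\<in>insert a A. M i j * z j) = M i a * l + (\<Sum>j\<in>A. M i j * (y j - l * c j))"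
      using insert.hyps by (auto simp: z_def intro!: sum.cong)
    then show ?thesis by (simp add: algebra_simps sum_subtractf sum_distrib_left)
  qed
  have "(\<Sum>j\<in>A. M a j * c j) = (\<Sum>p\<in>A. c p * M p a)"
    using sym by (intro sum.cong) (auto simp: mult_ac)
  then have "(\<Sum>j\<in>insert a A. M a j * z j) = (\<Sum>j\<in>A. M a j * y j) + s * l"
    unfolding red s_def by (simp add: algebra_simps)
  also have "\<dots> = x a" using \<open>s > 0\<close> unfolding l_def by simp
  finally have za: "(\<Sum>j\<in>insert a A. M a j * z j) = x a" .
  have zA: "(\<Sum>j\<in>insert a A. M i j * z j) = x i" if "i \<in> A" for i
    unfolding red c[OF that] y[OF that] by simp
  have "(\<Sum>j\<in>insert a A. M i j * z j) = x i" if "i \<in> insert a A" for i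
  proof (cases "i = a")
    case True
    show ?thesis unfolding True by (fact za)
  next
    case False
    with that have "i \<in> A" by simp
    then show ?thesis by (rule zA)
  qed
  then have "\<forall>i\<in>insert a A. (\<Sum>j\<in>insert a A. M i j * z j) = x i" by (rule ballI)
  then show ?case by (rule exI[of "\<lambda>y. \<forall>i\<in>insert a A. (\<Sum>j\<in>insert a A. M i j * y j) = x i" z])
qed

definition lin_solve :: "'v::finite set \<Rightarrow> ('v \<Rightarrow> 'v \<Rightarrow> real) \<Rightarrow> ('v \<Rightarrow> real) \<Rightarrow> 'v \<Rightarrow> real" where
  "lin_solve A M x = (SOME y. \<forall>i\<in>A. (\<Sum>j\<in>A. M i j * y j) = x i)"

lemma lin_solve:
  assumes "pos_def_on A M" "i \<in> A"
  shows "(\<Sum>j\<in>A. M i j * lin_solve A M x j) = x i"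
proof -
  define P where "P y \<longleftrightarrow> (\<forall>i\<in>A. (\<Sum>j\<in>A. M i j * y j) = x i)" for y
  have "\<exists>y. P y" unfolding P_def by (rule pos_def_on_solvable[OF assms(1)])
  then have "P (SOME y. P y)" by (rule someI_ex)
  moreover have "lin_solve A M x = (SOME y. P y)"
    unfolding lin_solve_def P_def by (rule refl)
  ultimately have "P (lin_solve A M x)" by (simp only:)
  then show ?thesis using assms(2) unfolding P_def by (rule bspec)
qed

text \<open>The coefficients and the residual variance of the regression of the coordinate \<open>a\<close> on the
  coordinates in \<open>A\<close>, for the covariance \<open>M\<close>.\<close>

definition regression_coeffs ::
  "'v::finite set \<Rightarrow> ('v \<Rightarrow> 'v \<Rightarrow> real) \<Rightarrow> 'v \<Rightarrow> 'v \<Rightarrow> real" where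
  "regression_coeffs A M a = lin_solve A M (\<lambda>q. M q a)"

definition residual_variance :: "'v::finite set \<Rightarrow> ('v \<Rightarrow> 'v \<Rightarrow> real) \<Rightarrow> 'v \<Rightarrow> real" where
  "residual_variance A M a = M a a - (\<Sum>p\<in>A. regression_coeffs A M a p * M p a)"

lemma regression_coeffs:
  assumes "pos_def_on A M" "q \<in> A"
  shows "(\<Sum>p\<in>A. M q p * regression_coeffs A M a p) = M q a"
  unfolding regression_coeffs_def by (rule lin_solve[OF assms])

lemma pos_def_on_insert_iff:
  fixes M :: "'v::finite \<Rightarrow> 'v \<Rightarrow> real"
  assumes a: "a \<notin> A"
    and sym: "\<And>i j. i \<in> insert a A \<Longrightarrow> j \<in> insert a A \<Longrightarrow> M i j = M j i"
    and pd: "pos_def_on A M"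
  shows "pos_def_on (insert a A) M \<longleftrightarrow> residual_variance A M a > 0"
  by (rule pos_def_on_insert[where M = M and c = "regression_coeffs A M a", OF a sym pd])
    (rule regression_coeffs[OF pd] residual_variance_def | assumption)+

lemma det_on_insert_eq:
  fixes M :: "'v::finite \<Rightarrow> 'v \<Rightarrow> real"
  assumes a: "a \<notin> A"
    and sym: "\<And>i j. i \<in> insert a A \<Longrightarrow> j \<in> insert a A \<Longrightarrow> M i j = M j i"
    and pd: "pos_def_on A M"
  shows "det_on (insert a A) M = residual_variance A M a * det_on A M"
proof (rule det_on_insert[where M = M and c = "regression_coeffs A M a", OF a])
  fix q assume q: "q \<in> A"
  have "M a q = (\<Sum>p\<in>A. M q p * regression_coeffs A M a p)"
    using regression_coeffs[OF pd q, of a] sym[of a q] q by simp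
  also have "\<dots> = (\<Sum>p\<in>A. regression_coeffs A M a p * M p q)"
    using q by (intro sum.cong refl) (simp add: sym mult.commute)
  finally show "M a q = (\<Sum>p\<in>A. regression_coeffs A M a p * M p q)" .
qed (simp add: residual_variance_def)

lemma det_on_pos:
  fixes M :: "'v::finite \<Rightarrow> 'v \<Rightarrow> real"
  assumes "pos_def_on A M"
  shows "det_on A M > 0"
  using finite[of A] assms
proof (induction A rule: finite_induct)
  case empty
  then show ?case by (simp add: det_on_empty)
next
  case (insert a A)
  have sym: "M i j = M j i" if "i \<in> insert a A" "j \<in> insert a A" for i j
    using insert.prems that unfolding pos_def_on_def by blast
  have pd: "pos_def_on A M" using insert.prems by (rule pos_def_on_subset) auto
  have "residual_variance A M a > 0"
    using pos_def_on_insert_iff[where M = M, OF insert.hyps(2) sym pd] insert.prems by simp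
  then show ?case
    using det_on_insert_eq[where M = M, OF insert.hyps(2) sym pd] insert.IH[OF pd] by simp
qed

text \<open>A form of Sylvester's criterion. It makes positive definiteness a measurable condition.\<close>

lemma pos_def_on_iff_det_on:
  fixes M :: "'v::finite \<Rightarrow> 'v \<Rightarrow> real"
  assumes "\<And>i j. i \<in> A \<Longrightarrow> j \<in> A \<Longrightarrow> M i j = M j i"
  shows "pos_def_on A M \<longleftrightarrow> (\<forall>B. B \<subseteq> A \<longrightarrow> det_on B M > 0)"
proof
  assume "pos_def_on A M"
  then show "\<forall>B. B \<subseteq> A \<longrightarrow> det_on B M > 0" using det_on_pos pos_def_on_subset by blast
next
  assume "\<forall>B. B \<subseteq> A \<longrightarrow> det_on B M > 0"
  with finite[of A] assms show "pos_def_on A M"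
  proof (induction A rule: finite_induct)
    case empty
    then show ?case by (simp add: pos_def_on_def)
  next
    case (insert a A)
    have det: "det_on B M > 0" if "B \<subseteq> insert a A" for B using insert.prems(2) that by blast
    have pd: "pos_def_on A M"
    proof (rule insert.IH)
      show "\<forall>B\<subseteq>A. 0 < det_on B M" using det by (simp add: subset_insertI2)
    qed (use insert.prems(1) in simp)
    have "residual_variance A M a * det_on A M > 0"
      using det[of "insert a A"] det_on_insert_eq[where M = M, OF insert.hyps(2) insert.prems(1) pd]
      by simp
    moreover have "det_on A M > 0" using det[of A] by blast
    ultimately have "residual_variance A M a > 0" by (simp add: zero_less_mult_iff)
    then show ?case
      using pos_def_on_insert_iff[where M = M, OF insert.hyps(2) insert.prems(1) pd] by simp
  qed
qed

section \<open>Gaussian and gamma integrals\<close>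

text \<open>The quadratic form of the inverse matrix, \<open>x\<^sup>T M\<^sup>-\<^sup>1 x\<close>.\<close>

definition inverse_form :: "'v::finite set \<Rightarrow> ('v \<Rightarrow> 'v \<Rightarrow> real) \<Rightarrow> ('v \<Rightarrow> real) \<Rightarrow> real" where
  "inverse_form A M x = (\<Sum>i\<in>A. x i * lin_solve A M x i)"

lemma inverse_form_eq:
  fixes M :: "'v::finite \<Rightarrow> 'v \<Rightarrow> real"
  assumes pd: "pos_def_on A M" and y: "\<And>i. i \<in> A \<Longrightarrow> (\<Sum>j\<in>A. M i j * y j) = x i"
  shows "inverse_form A M x = (\<Sum>i\<in>A. x i * y i)"
proof -
  define z where "z = lin_solve A M x"
  have z: "(\<Sum>j\<in>A. M i j * z j) = x i" if "i \<in> A" for i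
    unfolding z_def by (rule lin_solve[OF pd that])
  have sym: "M i j = M j i" if "i \<in> A" "j \<in> A" for i j
    using pd that unfolding pos_def_on_def by blast
  have "(\<Sum>i\<in>A. x i * z i) = (\<Sum>i\<in>A. \<Sum>j\<in>A. M i j * y j * z i)"
    by (intro sum.cong refl) (simp only: y[symmetric] sum_distrib_right)
  also have "\<dots> = (\<Sum>j\<in>A. \<Sum>i\<in>A. M i j * y j * z i)" by (rule sum.swap)
  also have "\<dots> = (\<Sum>j\<in>A. \<Sum>i\<in>A. M j i * z i * y j)"
  proof (intro sum.cong refl)
    fix i j assume "i \<in> A" "j \<in> A"
    then have "M i j = M j i" by (rule sym)
    then show "M i j * y j * z i = M j i * z i * y j" by (simp only: mult.assoc mult.commute mult.left_commute)
  qed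
  also have "\<dots> = (\<Sum>j\<in>A. x j * y j)"
    by (intro sum.cong refl) (simp only: z[symmetric] sum_distrib_right)
  finally show ?thesis unfolding inverse_form_def z_def .
qed

lemma inverse_form_cong:
  fixes M :: "'v::finite \<Rightarrow> 'v \<Rightarrow> real"
  assumes pd: "pos_def_on A M" and "\<And>i. i \<in> A \<Longrightarrow> x i = x' i"
  shows "inverse_form A M x = inverse_form A M x'"
proof -
  have "inverse_form A M x = (\<Sum>i\<in>A. x i * lin_solve A M x' i)"
  proof (rule inverse_form_eq[OF pd])
    fix i assume i: "i \<in> A"
    show "(\<Sum>j\<in>A. M i j * lin_solve A M x' j) = x i"
      unfolding assms(2)[OF i] by (rule lin_solve[OF pd i])
  qed
  also have "\<dots> = inverse_form A M x'"
    unfolding inverse_form_def by (intro sum.cong refl) (simp only: assms(2))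
  finally show ?thesis .
qed

lemma inverse_form_insert:
  fixes M :: "'v::finite \<Rightarrow> 'v \<Rightarrow> real"
  assumes a: "a \<notin> A" and pd: "pos_def_on (insert a A) M"
  shows "inverse_form (insert a A) M x = inverse_form A M x +
    (x a - (\<Sum>p\<in>A. regression_coeffs A M a p * x p))\<^sup>2 / residual_variance A M a"
proof -
  have sym: "M i j = M j i" if "i \<in> insert a A" "j \<in> insert a A" for i j
    using pd that unfolding pos_def_on_def by blast
  have pdA: "pos_def_on A M" using pd by (rule pos_def_on_subset) auto
  define c where "c = regression_coeffs A M a"
  define s where "s = residual_variance A M a"
  define y where "y = lin_solve (insert a A) M x"
  define d where "d = (\<Sum>p\<in>A. c p * x p)"
  have c: "(\<Sum>p\<in>A. M q p * c p) = M q a" if "q \<in> A" for q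
    unfolding c_def by (rule regression_coeffs[OF pdA that])
  have "s > 0"
    unfolding s_def using pos_def_on_insert_iff[where M = M, OF a sym pdA] pd by simp
  have s: "s = M a a - (\<Sum>p\<in>A. c p * M p a)" unfolding s_def c_def residual_variance_def ..
  have y: "(\<Sum>j\<in>A. M i j * y j) = x i - M i a * y a" if "i \<in> insert a A" for i
  proof -
    have "(\<Sum>j\<in>insert a A. M i j * y j) = x i" unfolding y_def by (rule lin_solve[OF pd that])
    then show ?thesis using a by simp
  qed
  have 1: "inverse_form A M x = (\<Sum>i\<in>A. x i * (y i + y a * c i))"
  proof (rule inverse_form_eq[OF pdA])
    fix i assume i: "i \<in> A"
    have "(\<Sum>j\<in>A. M i j * (y j + y a * c j)) = (\<Sum>j\<in>A. M i j * y j) + y a * (\<Sum>j\<in>A. M i j * c j)"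
      by (simp add: algebra_simps sum.distrib sum_distrib_left)
    also have "\<dots> = x i" using y[of i] c[OF i] i by simp
    finally show "(\<Sum>j\<in>A. M i j * (y j + y a * c j)) = x i" .
  qed
  have "(\<Sum>p\<in>A. c p * (\<Sum>j\<in>A. M p j * y j)) = (\<Sum>p\<in>A. \<Sum>j\<in>A. c p * M p j * y j)"
    by (simp add: sum_distrib_left mult.assoc)
  also have "\<dots> = (\<Sum>j\<in>A. \<Sum>p\<in>A. c p * M p j * y j)" by (rule sum.swap)
  also have "\<dots> = (\<Sum>j\<in>A. M a j * y j)"
  proof (rule sum.cong[OF refl])
    fix j assume j: "j \<in> A"
    have "(\<Sum>p\<in>A. c p * M p j * y j) = (\<Sum>p\<in>A. M j p * c p) * y j"
      unfolding sum_distrib_right using j by (intro sum.cong refl) (simp add: sym[of _ j] mult_ac)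
    then show "(\<Sum>p\<in>A. c p * M p j * y j) = M a j * y j" using c[OF j] sym[of a j] j by simp
  qed
  finally have 2: "(\<Sum>p\<in>A. c p * (\<Sum>j\<in>A. M p j * y j)) = (\<Sum>j\<in>A. M a j * y j)" .
  have "d = (\<Sum>p\<in>A. c p * ((\<Sum>j\<in>A. M p j * y j) + M p a * y a))"
    unfolding d_def by (intro sum.cong refl) (simp add: y)
  also have "\<dots> = (\<Sum>j\<in>A. M a j * y j) + (\<Sum>p\<in>A. c p * M p a) * y a"
    unfolding distrib_left sum.distrib 2 by (simp add: sum_distrib_right mult.assoc)
  also have "\<dots> = x a - s * y a"
  proof -
    have "s * y a = M a a * y a - (\<Sum>p\<in>A. c p * M p a) * y a" unfolding s by (rule left_diff_distrib)
    then show ?thesis using y[of a] by simp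
  qed
  finally have 3: "x a = d + s * y a" by simp
  have "inverse_form (insert a A) M x = x a * y a + (\<Sum>i\<in>A. x i * y i)"
    unfolding inverse_form_def y_def[symmetric] using a by simp
  also have "(\<Sum>i\<in>A. x i * y i) = inverse_form A M x - y a * d"
    unfolding 1 d_def by (simp add: algebra_simps sum.distrib sum_distrib_left)
  also have "x a * y a + (inverse_form A M x - y a * d) = inverse_form A M x + (s * y a)\<^sup>2 / s"
    unfolding 3 using \<open>s > 0\<close> by (simp add: power2_eq_square algebra_simps)
  finally show ?thesis unfolding c_def[symmetric] s_def[symmetric] d_def[symmetric] 3 by simp
qed

lemma borel_measurable_component:
  assumes "i \<in> I"
  shows "(\<lambda>z. z i) \<in> borel_measurable (\<Pi>\<^sub>M i\<in>I. (lborel :: real measure))"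
  using measurable_component_singleton[OF assms, of "\<lambda>_. lborel :: real measure"] by simp

lemma borel_measurable_inverse_form:
  fixes M :: "'v::finite \<Rightarrow> 'v \<Rightarrow> real" and f :: "'v \<Rightarrow> 'b"
  assumes "pos_def_on A M" "f ` A \<subseteq> I"
  shows "(\<lambda>z. inverse_form A M (\<lambda>i. z (f i) - m i)) \<in> borel_measurable (\<Pi>\<^sub>M i\<in>I. lborel)"
  using finite[of A] assms
proof (induction A rule: finite_induct)
  case empty
  then show ?case by (simp add: inverse_form_def)
next
  case (insert a A)
  have pd: "pos_def_on A M" using insert.prems(1) by (rule pos_def_on_subset) auto
  have IH: "(\<lambda>z. inverse_form A M (\<lambda>i. z (f i) - m i)) \<in> borel_measurable (\<Pi>\<^sub>M i\<in>I. lborel)"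
    by (rule insert.IH[OF pd]) (use insert.prems(2) in simp)
  have m: "(\<lambda>z. z (f i)) \<in> borel_measurable (\<Pi>\<^sub>M i\<in>I. (lborel :: real measure))" if "i \<in> insert a A" for i
    by (rule borel_measurable_component) (use that insert.prems(2) in blast)
  show ?case
    unfolding inverse_form_insert[OF insert.hyps(2) insert.prems(1)]
    by (intro borel_measurable_add borel_measurable_divide borel_measurable_power borel_measurable_diff
        borel_measurable_sum borel_measurable_times borel_measurable_const IH m) simp_all
qed

lemma nn_integral_gaussian_1:
  fixes h s \<mu> :: real
  assumes "h > 0" "s > 0"
  shows "(\<integral>\<^sup>+t. ennreal (exp (- h * ((t - \<mu>)\<^sup>2 / s))) \<partial>lborel) = ennreal (sqrt (pi / h) * sqrt s)"
proof -
  define \<sigma> where "\<sigma> = sqrt (s / (2 * h))"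
  have "\<sigma> > 0" unfolding \<sigma>_def using assms by simp
  have \<sigma>2: "2 * \<sigma>\<^sup>2 = s / h" unfolding \<sigma>_def using assms by simp
  have eq: "exp (- h * ((t - \<mu>)\<^sup>2 / s)) = sqrt (pi / h) * sqrt s * normal_density \<mu> \<sigma> t" for t
  proof -
    have "sqrt (2 * pi * \<sigma>\<^sup>2) = sqrt (pi / h) * sqrt s"
      using \<sigma>2 by (simp add: real_sqrt_mult[symmetric] algebra_simps)
    moreover have "sqrt (pi / h) * sqrt s > 0" using assms by simp
    moreover have "- (t - \<mu>)\<^sup>2 / (2 * \<sigma>\<^sup>2) = - h * ((t - \<mu>)\<^sup>2 / s)" unfolding \<sigma>2 by simp
    ultimately show ?thesis using assms unfolding normal_density_def by simp
  qed
  have "(\<integral>\<^sup>+t. ennreal (normal_density \<mu> \<sigma> t) \<partial>lborel) = 1"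
    using \<open>\<sigma> > 0\<close> by (simp add: nn_integral_eq_integral)
  then have "(\<integral>\<^sup>+t. ennreal (sqrt (pi / h) * sqrt s) * ennreal (normal_density \<mu> \<sigma> t) \<partial>lborel)
     = ennreal (sqrt (pi / h) * sqrt s)"
    by (subst nn_integral_cmult) simp_all
  then show ?thesis unfolding eq using assms by (simp add: ennreal_mult')
qed

text \<open>Adding the coordinate \<open>a\<close> to \<open>A\<close> adds one square to the exponent, whose integral over that
  coordinate does not depend on the others. The index map \<open>f\<close> names the coordinates of the space
  over which the integral is taken.\<close>

lemma nn_integral_gaussian:
  fixes M :: "'v::finite \<Rightarrow> 'v \<Rightarrow> real" and f :: "'v \<Rightarrow> 'b"
  assumes "pos_def_on A M" "inj_on f A" "h > 0"
  shows "(\<integral>\<^sup>+z. ennreal (exp (- h * inverse_form A M (\<lambda>i. z (f i) - m i))) \<partial>(\<Pi>\<^sub>M i\<in>f ` A. lborel)) =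
    ennreal (sqrt (pi / h) ^ card A * sqrt (det_on A M))"
  using finite[of A] assms(1,2)
proof (induction A rule: finite_induct)
  case empty
  interpret product_sigma_finite "\<lambda>_::'b. lborel :: real measure" by standard
  show ?case by (simp add: inverse_form_def det_on_empty space_PiM_empty emeasure_PiM_empty)
next
  case (insert a A)
  interpret product_sigma_finite "\<lambda>_::'b. lborel :: real measure" by standard
  have sym: "M i j = M j i" if "i \<in> insert a A" "j \<in> insert a A" for i j
    using insert.prems(1) that unfolding pos_def_on_def by blast
  have pd: "pos_def_on A M" using insert.prems(1) by (rule pos_def_on_subset) auto
  have fa: "f a \<notin> f ` A" using insert.prems(2) insert.hyps(2) by auto
  have inj: "inj_on f A" using insert.prems(2) by simp
  define s where "s = residual_variance A M a"
  define c where "c = regression_coeffs A M a"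
  have "s > 0"
    unfolding s_def using pos_def_on_insert_iff[where M = M, OF insert.hyps(2) sym pd] insert.prems(1) by simp
  have det: "det_on (insert a A) M = s * det_on A M"
    unfolding s_def by (rule det_on_insert_eq[where M = M, OF insert.hyps(2) sym pd])
  have split: "inverse_form (insert a A) M (\<lambda>i. (z(f a := t)) (f i) - m i) =
      inverse_form A M (\<lambda>i. z (f i) - m i) + (t - (m a + (\<Sum>p\<in>A. c p * (z (f p) - m p))))\<^sup>2 / s" for z t
  proof -
    have ne: "f i \<noteq> f a" if "i \<in> A" for i using imageI[OF that, of f] fa by metis
    have "inverse_form A M (\<lambda>i. (z(f a := t)) (f i) - m i) = inverse_form A M (\<lambda>i. z (f i) - m i)"
      by (rule inverse_form_cong[OF pd]) (simp add: ne)
    moreover have "(\<Sum>p\<in>A. c p * ((z(f a := t)) (f p) - m p)) = (\<Sum>p\<in>A. c p * (z (f p) - m p))"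
      by (intro sum.cong refl) (simp add: ne)
    ultimately show ?thesis
      unfolding inverse_form_insert[OF insert.hyps(2) insert.prems(1)] s_def[symmetric] c_def[symmetric]
      by (simp add: diff_diff_eq)
  qed
  have "(\<integral>\<^sup>+z. ennreal (exp (- h * inverse_form (insert a A) M (\<lambda>i. z (f i) - m i))) \<partial>(\<Pi>\<^sub>M i\<in>insert (f a) (f ` A). lborel)) =
    (\<integral>\<^sup>+z. \<integral>\<^sup>+t. ennreal (exp (- h * inverse_form (insert a A) M (\<lambda>i. (z(f a := t)) (f i) - m i))) \<partial>lborel \<partial>(\<Pi>\<^sub>M i\<in>f ` A. lborel))"
  proof (rule product_nn_integral_insert)
    have "(\<lambda>z. inverse_form (insert a A) M (\<lambda>i. z (f i) - m i)) \<in> borel_measurable (\<Pi>\<^sub>M i\<in>insert (f a) (f ` A). lborel)"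
      by (rule borel_measurable_inverse_form[OF insert.prems(1)]) simp
    then show "(\<lambda>z. ennreal (exp (- h * inverse_form (insert a A) M (\<lambda>i. z (f i) - m i)))) \<in> borel_measurable (\<Pi>\<^sub>M i\<in>insert (f a) (f ` A). lborel)"
      by measurable
  qed (use fa in simp_all)
  also have "\<dots> = (\<integral>\<^sup>+z. ennreal (exp (- h * inverse_form A M (\<lambda>i. z (f i) - m i))) * ennreal (sqrt (pi / h) * sqrt s) \<partial>(\<Pi>\<^sub>M i\<in>f ` A. lborel))"
  proof (rule nn_integral_cong)
    fix z :: "'b \<Rightarrow> real"
    define \<mu> where "\<mu> = m a + (\<Sum>p\<in>A. c p * (z (f p) - m p))"
    define q where "q = inverse_form A M (\<lambda>i. z (f i) - m i)"
    have "(\<integral>\<^sup>+t. ennreal (exp (- h * (q + (t - \<mu>)\<^sup>2 / s))) \<partial>lborel) =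
      (\<integral>\<^sup>+t. ennreal (exp (- h * q)) * ennreal (exp (- h * ((t - \<mu>)\<^sup>2 / s))) \<partial>lborel)"
      by (simp add: ennreal_mult'[symmetric] exp_add[symmetric] algebra_simps)
    also have "\<dots> = ennreal (exp (- h * q)) * ennreal (sqrt (pi / h) * sqrt s)"
      unfolding nn_integral_gaussian_1[OF assms(3) \<open>s > 0\<close>, of \<mu>, symmetric]
      by (rule nn_integral_cmult) measurable
    finally show "(\<integral>\<^sup>+t. ennreal (exp (- h * inverse_form (insert a A) M (\<lambda>i. (z(f a := t)) (f i) - m i))) \<partial>lborel) =
       ennreal (exp (- h * inverse_form A M (\<lambda>i. z (f i) - m i))) * ennreal (sqrt (pi / h) * sqrt s)"
      unfolding split \<mu>_def[symmetric] q_def[symmetric] .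
  qed
  also have "\<dots> = (\<integral>\<^sup>+z. ennreal (exp (- h * inverse_form A M (\<lambda>i. z (f i) - m i))) \<partial>(\<Pi>\<^sub>M i\<in>f ` A. lborel)) * ennreal (sqrt (pi / h) * sqrt s)"
  proof (rule nn_integral_multc)
    have "(\<lambda>z. inverse_form A M (\<lambda>i. z (f i) - m i)) \<in> borel_measurable (\<Pi>\<^sub>M i\<in>f ` A. lborel)"
      by (rule borel_measurable_inverse_form[OF pd]) simp
    then show "(\<lambda>z. ennreal (exp (- h * inverse_form A M (\<lambda>i. z (f i) - m i)))) \<in> borel_measurable (\<Pi>\<^sub>M i\<in>f ` A. lborel)"
      by measurable
  qed
  also have "\<dots> = ennreal (sqrt (pi / h) ^ card A * sqrt (det_on A M)) * ennreal (sqrt (pi / h) * sqrt s)"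
    unfolding insert.IH[OF pd inj] ..
  also have "\<dots> = ennreal (sqrt (pi / h) ^ card (insert a A) * sqrt (det_on (insert a A) M))"
    using insert.hyps assms(3) \<open>s > 0\<close> unfolding det
    by (simp add: ennreal_mult'[symmetric] real_sqrt_mult mult_ac)
  finally show ?case by simp
qed

definition gamma_integral :: "real \<Rightarrow> real \<Rightarrow> ennreal" where
  "gamma_integral h e = (\<integral>\<^sup>+t. indicator {0<..} t * ennreal (exp (- h * t) * t powr e) \<partial>lborel)"

lemma gamma_integral_finite:
  assumes "h > 0" "e > -1"
  shows "gamma_integral h e < \<infinity>"
proof -
  define F where "F t = complex_of_real t powr (complex_of_real (e + 1) - 1) / of_real (exp (h * t))" for t
  have "F absolutely_integrable_on {0<..}"
    unfolding F_def by (rule absolutely_integrable_Gamma_integral) (use assms in simp_all)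
  then have "integrable lebesgue (\<lambda>t. indicator {0<..} t *\<^sub>R F t)"
    unfolding set_integrable_def .
  then have "(\<integral>\<^sup>+t. ennreal (norm (indicator {0<..} t *\<^sub>R F t)) \<partial>lebesgue) < \<infinity>"
    by (simp add: integrable_iff_bounded)
  also have "(\<integral>\<^sup>+t. ennreal (norm (indicator {0<..} t *\<^sub>R F t)) \<partial>lebesgue) =
     (\<integral>\<^sup>+t. indicator {0<..} t * ennreal (exp (- h * t) * t powr e) \<partial>lebesgue)"
  proof (rule nn_integral_cong)
    fix t :: real
    show "ennreal (norm (indicator {0<..} t *\<^sub>R F t)) = indicator {0<..} t * ennreal (exp (- h * t) * t powr e)"
    proof (cases "t > 0")
      case True
      have "norm (F t) = t powr e * exp (- (h * t))"
        using True unfolding F_def by (simp add: norm_divide norm_powr_real_powr exp_minus field_simps)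
      then show ?thesis using True by (simp add: mult.commute)
    qed simp
  qed
  finally show ?thesis unfolding gamma_integral_def nn_integral_completion .
qed

text \<open>The integral over the row of a new vertex \<open>a\<close>: the residual variance contributes a gamma
  integral, the covariances with \<open>A\<close> a Gaussian one. Here \<open>z\<close> holds the new row, and the exponent
  is the quadratic form of the extended matrix at \<open>w\<close>.\<close>

lemma nn_integral_regression:
  fixes M :: "'v::finite \<Rightarrow> 'v \<Rightarrow> real" and f :: "'v \<Rightarrow> 'b" and w :: "'v \<Rightarrow> real"
    and a :: 'v
  defines "N \<equiv> \<lambda>z i j. if i = a then z (f j) else if j = a then z (f i) else M i j"
  assumes a: "a \<notin> A" and pd: "pos_def_on A M" and inj: "inj_on f (insert a A)"
    and h: "h > 0" and wa: "w a = 1"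
  shows "(\<integral>\<^sup>+z. (if pos_def_on (insert a A) (N z) then
      ennreal (exp (- h * (\<Sum>i\<in>insert a A. \<Sum>j\<in>insert a A. w i * N z i j * w j)) *
        (det_on (insert a A) (N z) / det_on A M) powr e) else 0) \<partial>(\<Pi>\<^sub>M i\<in>f ` insert a A. lborel)) =
    gamma_integral h e * ennreal (sqrt (pi / h) ^ card A * sqrt (det_on A M))"
proof -
  interpret product_sigma_finite "\<lambda>_::'b. lborel :: real measure" by standard
  have symM: "M i j = M j i" if "i \<in> A" "j \<in> A" for i j
    using pd that unfolding pos_def_on_def by blast
  have fa: "f a \<notin> f ` A" using inj a by auto
  have injA: "inj_on f A" using inj by simp
  have ne: "f i \<noteq> f a" if "i \<in> A" for i using imageI[OF that, of f] fa by metis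
  have nea: "i \<noteq> a" if "i \<in> A" for i using that a by blast
  define m where "m i = - (\<Sum>j\<in>A. M i j * w j)" for i
  define q where "q z = inverse_form A M (\<lambda>i. z (f i))" for z :: "'b \<Rightarrow> real"
  define G where "G t = indicator {0<..} t * ennreal (exp (- h * t) * t powr e)" for t :: real
  define g where "g z = ennreal (exp (- h * inverse_form A M (\<lambda>i. z (f i) - m i)))" for z :: "'b \<Rightarrow> real"
  have NM: "N z i j = M i j" if "i \<in> A" "j \<in> A" for z i j
    unfolding N_def using nea that by simp
  have symN: "N z i j = N z j i" if "i \<in> insert a A" "j \<in> insert a A" for z i j
    using that by (auto simp: N_def symM)
  have pdN: "pos_def_on A (N z)" for z
    using pd pos_def_on_cong[where A = A and M = "N z" and N = M, OF NM] by simp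
  have detA: "det_on A (N z) = det_on A M" for z by (rule det_on_cong[OF NM])
  have integrand: "(if pos_def_on (insert a A) (N z) then
      ennreal (exp (- h * (\<Sum>i\<in>insert a A. \<Sum>j\<in>insert a A. w i * N z i j * w j)) *
        (det_on (insert a A) (N z) / det_on A M) powr e) else 0) = G (z (f a) - q z) * g z" for z
  proof -
    define c where "c = regression_coeffs A (N z) a"
    define s where "s = residual_variance A (N z) a"
    have c: "(\<Sum>p\<in>A. M i p * c p) = z (f i)" if i: "i \<in> A" for i
    proof -
      have "(\<Sum>p\<in>A. M i p * c p) = (\<Sum>p\<in>A. N z i p * c p)"
        using i by (intro sum.cong refl) (simp add: NM)
      also have "\<dots> = N z i a" unfolding c_def by (rule regression_coeffs[OF pdN i])
      finally show ?thesis using nea[OF i] by (simp add: N_def)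
    qed
    have q: "q z = (\<Sum>i\<in>A. z (f i) * c i)" unfolding q_def by (rule inverse_form_eq[OF pd c])
    have sN: "s = N z a a - (\<Sum>p\<in>A. c p * N z p a)" unfolding s_def c_def residual_variance_def ..
    have "(\<Sum>p\<in>A. c p * N z p a) = q z"
      unfolding q by (intro sum.cong refl) (simp add: N_def nea)
    then have s: "s = z (f a) - q z" using sN by (simp add: N_def)
    have det: "det_on (insert a A) (N z) / det_on A M = s"
      using det_on_insert_eq[where M = "N z", OF a symN pdN] det_on_pos[OF pd]
      unfolding s_def[symmetric] detA by simp
    have pos: "pos_def_on (insert a A) (N z) \<longleftrightarrow> s > 0"
      unfolding s_def by (rule pos_def_on_insert_iff[where M = "N z", OF a symN pdN])
    have "inverse_form A M (\<lambda>i. z (f i) - m i) = (\<Sum>i\<in>A. (z (f i) - m i) * (c i + w i))"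
    proof (rule inverse_form_eq[OF pd])
      fix i assume "i \<in> A"
      then show "(\<Sum>j\<in>A. M i j * (c j + w j)) = z (f i) - m i"
        using c[of i] by (simp add: m_def distrib_left sum.distrib)
    qed
    also have "\<dots> = (\<Sum>i\<in>A. \<Sum>j\<in>A. (w i + w a * c i) * N z i j * (w j + w a * c j))"
    proof (rule sum.cong[OF refl])
      fix i assume i: "i \<in> A"
      have "z (f i) - m i = (\<Sum>j\<in>A. M i j * (c j + w j))"
        using c[OF i] by (simp add: m_def distrib_left sum.distrib)
      then have "(z (f i) - m i) * (c i + w i) = (\<Sum>j\<in>A. M i j * (c j + w j) * (c i + w i))"
        by (simp only: sum_distrib_right)
      also have "\<dots> = (\<Sum>j\<in>A. (w i + w a * c i) * N z i j * (w j + w a * c j))"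
        using i by (intro sum.cong refl) (simp add: NM wa algebra_simps)
      finally show "(z (f i) - m i) * (c i + w i) = (\<Sum>j\<in>A. (w i + w a * c i) * N z i j * (w j + w a * c j))" .
    qed
    finally have quad: "(\<Sum>i\<in>insert a A. \<Sum>j\<in>insert a A. w i * N z i j * w j) =
      inverse_form A M (\<lambda>i. z (f i) - m i) + s"
      using quadratic_form_insert[where M = "N z" and c = c and x = w, OF a symN _ sN]
        regression_coeffs[OF pdN, of _ z a, folded c_def] wa by simp
    show ?thesis
      unfolding det pos quad g_def G_def s[symmetric]
      by (simp add: ennreal_mult'[symmetric] exp_add[symmetric] algebra_simps)
  qed
  have qm: "q \<in> borel_measurable (\<Pi>\<^sub>M i\<in>I. lborel)" if "f ` A \<subseteq> I" for I
    using borel_measurable_inverse_form[OF pd that, of "\<lambda>_. 0"] unfolding q_def[abs_def] by simp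
  have gm: "g \<in> borel_measurable (\<Pi>\<^sub>M i\<in>I. lborel)" if "f ` A \<subseteq> I" for I
    using borel_measurable_inverse_form[OF pd that, of m] unfolding g_def[abs_def] by measurable
  have Gm: "G \<in> borel_measurable borel" unfolding G_def[abs_def] by measurable
  have "(\<integral>\<^sup>+z. G (z (f a) - q z) * g z \<partial>(\<Pi>\<^sub>M i\<in>insert (f a) (f ` A). lborel)) =
    (\<integral>\<^sup>+z. \<integral>\<^sup>+t. G ((z(f a := t)) (f a) - q (z(f a := t))) * g (z(f a := t)) \<partial>lborel \<partial>(\<Pi>\<^sub>M i\<in>f ` A. lborel))"
  proof (rule product_nn_integral_insert)
    have "(\<lambda>z. z (f a) - q z) \<in> borel_measurable (\<Pi>\<^sub>M i\<in>insert (f a) (f ` A). lborel)"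
      by (intro borel_measurable_diff borel_measurable_component qm) auto
    then show "(\<lambda>z. G (z (f a) - q z) * g z) \<in> borel_measurable (\<Pi>\<^sub>M i\<in>insert (f a) (f ` A). lborel)"
      by (intro borel_measurable_times_ennreal measurable_compose[OF _ Gm] gm) auto
  qed (use fa in simp_all)
  also have "\<dots> = (\<integral>\<^sup>+z. gamma_integral h e * g z \<partial>(\<Pi>\<^sub>M i\<in>f ` A. lborel))"
  proof (rule nn_integral_cong)
    fix z :: "'b \<Rightarrow> real"
    have q: "q (z(f a := t)) = q z" for t
      unfolding q_def by (rule inverse_form_cong[OF pd]) (simp add: ne)
    have g: "g (z(f a := t)) = g z" for t
    proof -
      have "inverse_form A M (\<lambda>i. (z(f a := t)) (f i) - m i) = inverse_form A M (\<lambda>i. z (f i) - m i)"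
        by (rule inverse_form_cong[OF pd]) (simp add: ne)
      then show ?thesis unfolding g_def by simp
    qed
    have "(\<integral>\<^sup>+t. G ((z(f a := t)) (f a) - q (z(f a := t))) * g (z(f a := t)) \<partial>lborel) =
      (\<integral>\<^sup>+t. G (- q z + 1 * t) * g z \<partial>lborel)"
      unfolding q g by simp
    also have "\<dots> = (\<integral>\<^sup>+t. G (- q z + 1 * t) \<partial>lborel) * g z"
      by (rule nn_integral_multc) (intro measurable_compose[OF _ Gm], simp)
    also have "(\<integral>\<^sup>+t. G (- q z + 1 * t) \<partial>lborel) = gamma_integral h e"
      unfolding gamma_integral_def G_def[symmetric]
      using nn_integral_real_affine[OF Gm, of 1 "- q z"] by simp
    finally show "(\<integral>\<^sup>+t. G ((z(f a := t)) (f a) - q (z(f a := t))) * g (z(f a := t)) \<partial>lborel) =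
      gamma_integral h e * g z" .
  qed
  also have "\<dots> = gamma_integral h e * (\<integral>\<^sup>+z. g z \<partial>(\<Pi>\<^sub>M i\<in>f ` A. lborel))"
    by (rule nn_integral_cmult) (rule gm, simp)
  also have "(\<integral>\<^sup>+z. g z \<partial>(\<Pi>\<^sub>M i\<in>f ` A. lborel)) = ennreal (sqrt (pi / h) ^ card A * sqrt (det_on A M))"
    unfolding g_def by (rule nn_integral_gaussian[OF pd injA h])
  finally show ?thesis unfolding integrand by simp
qed

section \<open>Perfect acyclic orientations and completions\<close>

definition parents :: "'v rel \<Rightarrow> 'v \<Rightarrow> 'v set" where
  "parents D v = {i. (i, v) \<in> D}"

definition family :: "'v rel \<Rightarrow> 'v \<Rightarrow> 'v set" where
  "family D v = insert v (parents D v)"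

text \<open>Relative to \<open>S\<close>, a set that is closed under parents arises by adding one vertex at a time,
  after its parents: its last vertex is a sink, which acyclicity provides.\<close>

lemma parent_closed_induct [consumes 3, case_names base step]:
  fixes D :: "'v::finite rel"
  assumes "acyclic D" "S \<subseteq> A" "\<forall>v\<in>A - S. parents D v \<subseteq> A"
    and "P S"
    and "\<And>T v. S \<subseteq> T \<Longrightarrow> T \<subseteq> A \<Longrightarrow> \<forall>w\<in>T - S. parents D w \<subseteq> T \<Longrightarrow>
      v \<in> A - T \<Longrightarrow> parents D v \<subseteq> T \<Longrightarrow> P T \<Longrightarrow> P (insert v T)"
  shows "P A"
proof -
  have "P T" if "S \<subseteq> T" "T \<subseteq> A" "\<And>v. v \<in> T - S \<Longrightarrow> parents D v \<subseteq> T" for T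
    using finite[of T] that
  proof (induction T rule: finite_psubset_induct)
    case (psubset T)
    show ?case
    proof (cases "T = S")
      case True
      then show ?thesis using assms(4) by simp
    next
      case False
      then obtain x where "x \<in> T - S" using psubset.prems(1) by blast
      moreover have "wf (D\<inverse>)"
        by (rule finite_acyclic_wf_converse) (use assms(1) in simp_all)
      ultimately obtain v where v: "v \<in> T - S" and min: "\<And>y. (y, v) \<in> D\<inverse> \<Longrightarrow> y \<notin> T - S"
        unfolding wf_eq_minimal by metis
      have vv: "(v, v) \<notin> D" using assms(1) unfolding acyclic_def by blast
      define T' where "T' = T - {v}"
      have T: "T = insert v T'" unfolding T'_def using v by blast
      have closed: "parents D w \<subseteq> T'" if "w \<in> T' - S" for w
      proof -
        have "(v, w) \<notin> D" using min[of w] that unfolding T'_def by blast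
        moreover have "parents D w \<subseteq> T" using psubset.prems(3) that unfolding T'_def by blast
        ultimately show ?thesis unfolding T'_def parents_def by blast
      qed
      have "P T'"
        by (rule psubset.IH) (use psubset.prems v closed in \<open>auto simp: T'_def\<close>)
      moreover have "parents D v \<subseteq> T'"
        using psubset.prems(3)[OF v] vv unfolding T'_def parents_def by blast
      moreover have "S \<subseteq> T'" "T' \<subseteq> A" "v \<in> A - T'"
        using psubset.prems(1,2) v unfolding T'_def by blast+
      moreover have "\<forall>w\<in>T' - S. parents D w \<subseteq> T'" using closed by blast
      ultimately have "P (insert v T')" by (intro assms(5))
      then show ?thesis using T by simp
    qed
  qed
  then show ?thesis using assms(2,3) by blast
qed

lemma complete_in_subset: "complete_in E A \<Longrightarrow> B \<subseteq> A \<Longrightarrow> complete_in E B"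
  unfolding complete_in_def by blast

lemma complete_in_imp_clique:
  fixes E :: "'v::finite set set"
  assumes "complete_in E A"
  obtains B where "clique E B" "A \<subseteq> B"
proof -
  have "finite {B. complete_in E B}" "A \<in> {B. complete_in E B}" using assms by simp_all
  then obtain B where "A \<subseteq> B" "complete_in E B" "\<And>B'. complete_in E B' \<Longrightarrow> B \<subseteq> B' \<Longrightarrow> B = B'"
    using finite_has_maximal2[of "{B. complete_in E B}" A] by (metis mem_Collect_eq)
  then show ?thesis using that[of B] unfolding clique_def by metis
qed

abbreviation edge_matrix :: "('v set \<Rightarrow> real) \<Rightarrow> 'v \<Rightarrow> 'v \<Rightarrow> real" where
  "edge_matrix \<Gamma> \<equiv> \<lambda>i j. \<Gamma> {i, j}"

lemma edge_matrix_sym: "edge_matrix \<Gamma> i j = edge_matrix \<Gamma> j i"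
  by (simp add: insert_commute)

lemma Q_G_pos_def_on:
  assumes "\<Gamma> \<in> Q_G E" "complete_in E A"
  shows "pos_def_on A (edge_matrix \<Gamma>)"
proof -
  obtain B where "clique E B" "A \<subseteq> B" using complete_in_imp_clique[OF assms(2)] .
  then show ?thesis using assms(1) pos_def_on_subset unfolding Q_G_def by blast
qed

text \<open>For the difference \<open>X\<close> of the two matrices, the trace of \<open>K\<^sub>1 X K\<^sub>2 X\<close> vanishes: the matrix
  \<open>K\<^sub>1 X K\<^sub>2 = K\<^sub>2 - K\<^sub>1\<close> lives on the edges, and \<open>X\<close> lives off them. As \<open>K\<^sub>1\<close> is the sum of squares
  \<open>\<Sum>\<^sub>v w\<^sub>v w\<^sub>v\<^sup>T / u\<^sub>v\<close>, this trace is also the sum over \<open>v\<close> of the values of the positive definite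
  form \<open>K\<^sub>2\<close> at \<open>X w\<^sub>v\<close>, divided by \<open>u\<^sub>v\<close>. So every \<open>X w\<^sub>v\<close> is zero, and with them \<open>X K\<^sub>1\<close> and \<open>X\<close>.\<close>

lemma completion_unique_aux:
  fixes S1 K1 S2 K2 :: "real ^ 'v::finite ^ 'v" and w :: "'v \<Rightarrow> 'v \<Rightarrow> real" and u :: "'v \<Rightarrow> real"
  assumes SK1: "S1 ** K1 = mat 1" and SK2: "S2 ** K2 = mat 1"
    and sym: "\<And>i j. S1 $ i $ j = S1 $ j $ i" "\<And>i j. S2 $ i $ j = S2 $ j $ i"
    and pd: "pos_def_on UNIV (\<lambda>i j. S2 $ i $ j)"
    and K1: "\<And>i j. K1 $ i $ j = (\<Sum>v\<in>UNIV. w v i * w v j / u v)" and u: "\<And>v. u v > 0"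
    and agree: "\<And>i j. {i, j} \<in> E \<Longrightarrow> S1 $ i $ j = S2 $ i $ j"
    and off: "\<And>i j. {i, j} \<notin> E \<Longrightarrow> K1 $ i $ j = K2 $ i $ j"
  shows "S1 = S2"
proof -
  define X where "X = S1 - S2"
  have KS1: "K1 ** S1 = mat 1" by (rule matrix_left_right_inverse1[OF SK1])
  have symX: "X $ i $ j = X $ j $ i" for i j unfolding X_def using sym by simp
  \<comment> \<open>The value of the form \<open>K\<^sub>2\<close> at \<open>X w\<^sub>v\<close> is that of \<open>S\<^sub>2\<close> at \<open>y\<^sub>v\<close>.\<close>
  define y where "y v = K2 *v (X *v (\<chi> i. w v i))" for v
  have Xw: "S2 *v y v = X *v (\<chi> i. w v i)" for v
    unfolding y_def by (simp only: matrix_vector_mul_assoc matrix_mul_assoc SK2 matrix_mul_lid)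
  have quad: "trace (K1 ** X ** K2 ** X) = (\<Sum>v\<in>UNIV. (\<Sum>i\<in>UNIV. \<Sum>j\<in>UNIV. y v $ i * S2 $ i $ j * y v $ j) / u v)"
  proof -
    have "(\<Sum>i\<in>UNIV. \<Sum>j\<in>UNIV. y v $ i * S2 $ i $ j * y v $ j) =
        (\<Sum>k\<in>UNIV. \<Sum>l\<in>UNIV. w v k * w v l * (X ** K2 ** X) $ l $ k)" for v
    proof -
      have "(\<Sum>i\<in>UNIV. \<Sum>j\<in>UNIV. y v $ i * S2 $ i $ j * y v $ j) = (S2 *v y v) \<bullet> y v"
        by (simp add: inner_vec_def matrix_vector_mult_def sum_distrib_left sum_distrib_right mult_ac)
      also have "\<dots> = (X *v (\<chi> i. w v i)) \<bullet> (K2 *v (X *v (\<chi> i. w v i)))"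
        unfolding Xw by (simp add: y_def)
      also have "\<dots> = (\<chi> i. w v i) \<bullet> ((X ** K2 ** X) *v (\<chi> i. w v i))"
      proof -
        have "transpose X = X" unfolding transpose_def by (simp add: vec_eq_iff symX)
        then have "(X *v a) \<bullet> b = a \<bullet> (X *v b)" for a b
          by (metis dot_lmul_matrix vector_transpose_matrix)
        then show ?thesis by (simp add: matrix_vector_mul_assoc matrix_mul_assoc)
      qed
      also have "\<dots> = (\<Sum>l\<in>UNIV. \<Sum>k\<in>UNIV. w v k * w v l * (X ** K2 ** X) $ l $ k)"
        unfolding inner_vec_def matrix_vector_mult_def by (simp add: sum_distrib_left mult_ac)
      also have "\<dots> = (\<Sum>k\<in>UNIV. \<Sum>l\<in>UNIV. w v k * w v l * (X ** K2 ** X) $ l $ k)"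
        by (rule sum.swap)
      finally show ?thesis .
    qed
    then have "(\<Sum>v\<in>UNIV. (\<Sum>i\<in>UNIV. \<Sum>j\<in>UNIV. y v $ i * S2 $ i $ j * y v $ j) / u v) =
       (\<Sum>v\<in>UNIV. \<Sum>k\<in>UNIV. \<Sum>l\<in>UNIV. w v k * w v l / u v * (X ** K2 ** X) $ l $ k)"
      by (simp add: sum_divide_distrib)
    also have "\<dots> = (\<Sum>k\<in>UNIV. \<Sum>v\<in>UNIV. \<Sum>l\<in>UNIV. w v k * w v l / u v * (X ** K2 ** X) $ l $ k)"
      by (rule sum.swap)
    also have "\<dots> = (\<Sum>k\<in>UNIV. \<Sum>l\<in>UNIV. \<Sum>v\<in>UNIV. w v k * w v l / u v * (X ** K2 ** X) $ l $ k)"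
      by (rule sum.cong[OF refl]) (rule sum.swap)
    also have "\<dots> = (\<Sum>k\<in>UNIV. \<Sum>l\<in>UNIV. K1 $ k $ l * (X ** K2 ** X) $ l $ k)"
      by (simp add: K1 sum_distrib_right)
    also have "\<dots> = trace (K1 ** (X ** K2 ** X))"
      unfolding trace_def by (simp add: matrix_matrix_mult_def[of K1])
    finally show ?thesis by (simp add: matrix_mul_assoc)
  qed
  have "K1 ** X ** K2 = K2 - K1"
  proof -
    have "K1 ** X = K1 ** S1 - K1 ** S2"
      unfolding X_def by (simp add: vec_eq_iff matrix_matrix_mult_def right_diff_distrib sum_subtractf)
    moreover have "(K1 ** S1 - K1 ** S2) ** K2 = K1 ** S1 ** K2 - K1 ** S2 ** K2"
      by (simp add: vec_eq_iff matrix_matrix_mult_def[of _ K2] left_diff_distrib sum_subtractf)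
    ultimately have "K1 ** X ** K2 = K1 ** S1 ** K2 - K1 ** (S2 ** K2)"
      by (simp add: matrix_mul_assoc)
    then show ?thesis unfolding KS1 SK2 by simp
  qed
  then have "trace (K1 ** X ** K2 ** X) = (\<Sum>i\<in>UNIV. \<Sum>j\<in>UNIV. (K2 - K1) $ i $ j * X $ j $ i)"
    unfolding trace_def by (simp add: matrix_matrix_mult_def)
  also have "\<dots> = 0"
  proof (intro sum.neutral ballI)
    fix i j
    show "(K2 - K1) $ i $ j * X $ j $ i = 0"
    proof (cases "{i, j} \<in> E")
      case True
      then have "{j, i} \<in> E" by (simp add: insert_commute)
      then show ?thesis using agree[of j i] by (simp add: X_def)
    next
      case False
      then show ?thesis using off[of i j] by simp
    qed
  qed
  finally have tr0: "(\<Sum>v\<in>UNIV. (\<Sum>i\<in>UNIV. \<Sum>j\<in>UNIV. y v $ i * S2 $ i $ j * y v $ j) / u v) = 0"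
    unfolding quad .
  have pos: "(\<Sum>i\<in>UNIV. \<Sum>j\<in>UNIV. z $ i * S2 $ i $ j * z $ j) > 0" if "z \<noteq> 0" for z :: "real ^ 'v"
  proof -
    have "\<exists>i\<in>UNIV. z $ i \<noteq> 0" using that by (simp add: vec_eq_iff)
    then show ?thesis using pd unfolding pos_def_on_def by blast
  qed
  have nonneg: "(\<Sum>i\<in>UNIV. \<Sum>j\<in>UNIV. z $ i * S2 $ i $ j * z $ j) \<ge> 0" for z :: "real ^ 'v"
    using pos[of z] by (cases "z = 0") auto
  have y0: "y v = 0" for v
  proof (rule ccontr)
    assume "y v \<noteq> 0"
    have "\<forall>v\<in>UNIV. (\<Sum>i\<in>UNIV. \<Sum>j\<in>UNIV. y v $ i * S2 $ i $ j * y v $ j) / u v = 0"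
      using tr0 by (subst (asm) sum_nonneg_eq_0_iff) (auto intro!: divide_nonneg_pos nonneg u)
    then have "(\<Sum>i\<in>UNIV. \<Sum>j\<in>UNIV. y v $ i * S2 $ i $ j * y v $ j) / u v = 0" by (rule bspec) simp
    then have "(\<Sum>i\<in>UNIV. \<Sum>j\<in>UNIV. y v $ i * S2 $ i $ j * y v $ j) = 0" using u[of v] by simp
    then show False using pos[OF \<open>y v \<noteq> 0\<close>] by simp
  qed
  have Xw0: "(\<Sum>j\<in>UNIV. X $ i $ j * w v j) = 0" for i v
  proof -
    have "X *v (\<chi> i. w v i) = 0" unfolding Xw[symmetric] y0 by simp
    then have "(X *v (\<chi> i. w v i)) $ i = 0" by simp
    then show ?thesis by (simp add: matrix_vector_mult_def)
  qed
  have "X ** K1 = 0"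
  proof -
    have "(X ** K1) $ i $ k = 0" for i k
    proof -
      have "(X ** K1) $ i $ k = (\<Sum>j\<in>UNIV. \<Sum>v\<in>UNIV. X $ i $ j * w v j * (w v k / u v))"
        by (simp add: matrix_matrix_mult_def K1 sum_distrib_left mult_ac)
      also have "\<dots> = (\<Sum>v\<in>UNIV. \<Sum>j\<in>UNIV. X $ i $ j * w v j * (w v k / u v))" by (rule sum.swap)
      also have "\<dots> = 0" unfolding sum_distrib_right[symmetric] Xw0 by simp
      finally show ?thesis .
    qed
    then show ?thesis by (simp add: vec_eq_iff)
  qed
  then have "X ** (K1 ** S1) = 0" by (simp add: matrix_mul_assoc)
  then have "X = 0" unfolding KS1 by simp
  then show ?thesis unfolding X_def by simp
qed

text \<open>The setting for completing matrices and for integrating. DAG versions that are induced by a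
  perfect order satisfy it, since the new vertices of a clique have their parents in that clique.\<close>

locale perfect_dag =
  fixes E :: "'v::finite set set" and D :: "'v rel"
  assumes undirected: "undirected_graph E"
    and dag: "dag_version E D"
    and complete_parents: "complete_in E (parents D v)"
begin

lemma acyclic: "acyclic D" using dag unfolding dag_version_def by blast

lemma not_parent: "v \<notin> parents D v"
  using acyclic unfolding parents_def acyclic_def by blast

lemma loop: "{v} \<in> E" using undirected unfolding undirected_graph_def by blast

lemma parent_edge:
  assumes "i \<in> parents D v"
  shows "{i, v} \<in> E"
proof -
  have "i \<noteq> v" using assms not_parent by blast
  then show ?thesis using dag assms unfolding dag_version_def parents_def by blast
qed

lemma edge_cases:
  assumes "{i, j} \<in> E"
  shows "i = j \<or> i \<in> parents D j \<or> j \<in> parents D i"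
  using assms dag unfolding dag_version_def parents_def by blast

lemma complete_family: "complete_in E (family D v)"
  using complete_parents[of v] parent_edge[of _ v] loop[of v] unfolding complete_in_def family_def
  by (auto simp: insert_commute)

context
  fixes \<Gamma> :: "'v set \<Rightarrow> real"
  assumes \<Gamma>: "\<Gamma> \<in> Q_G E"
begin

lemma pos_def_parents: "pos_def_on (parents D v) (edge_matrix \<Gamma>)"
  by (rule Q_G_pos_def_on[OF \<Gamma> complete_parents])

lemma pos_def_family: "pos_def_on (family D v) (edge_matrix \<Gamma>)"
  by (rule Q_G_pos_def_on[OF \<Gamma> complete_family])

end

definition cond_var :: "('v set \<Rightarrow> real) \<Rightarrow> 'v \<Rightarrow> real" where
  "cond_var \<Gamma> v = residual_variance (parents D v) (edge_matrix \<Gamma>) v"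

text \<open>The residual of \<open>v\<close> in its regression on its parents, as a linear form in all vertices.\<close>

definition residual :: "('v set \<Rightarrow> real) \<Rightarrow> 'v \<Rightarrow> 'v \<Rightarrow> real" where
  "residual \<Gamma> v i = (if i = v then 1 else if i \<in> parents D v
     then - regression_coeffs (parents D v) (edge_matrix \<Gamma>) v i else 0)"

definition precision :: "('v set \<Rightarrow> real) \<Rightarrow> 'v set \<Rightarrow> 'v \<Rightarrow> 'v \<Rightarrow> real" where
  "precision \<Gamma> A i j = (\<Sum>v\<in>A. residual \<Gamma> v i * residual \<Gamma> v j / cond_var \<Gamma> v)"

lemma residual_outside: "i \<notin> family D v \<Longrightarrow> residual \<Gamma> v i = 0"
  unfolding residual_def family_def by simp

lemma precision_off_edges:
  assumes "{i, j} \<notin> E"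
  shows "precision \<Gamma> A i j = 0"
  unfolding precision_def
proof (rule sum.neutral, rule ballI)
  fix v
  have "i \<notin> family D v \<or> j \<notin> family D v"
    using complete_family[of v] assms unfolding complete_in_def by blast
  then show "residual \<Gamma> v i * residual \<Gamma> v j / cond_var \<Gamma> v = 0"
    using residual_outside by fastforce
qed

lemma cond_var_pos:
  assumes "\<Gamma> \<in> Q_G E"
  shows "cond_var \<Gamma> v > 0"
  unfolding cond_var_def
  using pos_def_on_insert_iff[OF not_parent edge_matrix_sym pos_def_parents[OF assms]]
    pos_def_family[OF assms, of v] unfolding family_def by simp

text \<open>Completions exist on every set that is closed under parents: a sink \<open>v\<close> is attached to a
  completion \<open>S\<close> on the other vertices by making its residual uncorrelated with them. The inverse matrix then gains the square of the residual form.\<close>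

lemma partial_completion:
  assumes \<Gamma>: "\<Gamma> \<in> Q_G E" and "\<forall>v\<in>A - {}. parents D v \<subseteq> A"
  shows "\<exists>S. (\<forall>i\<in>A. \<forall>j\<in>A. S i j = S j i) \<and> (\<forall>i\<in>A. \<forall>j\<in>A. {i, j} \<in> E \<longrightarrow> S i j = \<Gamma> {i, j}) \<and>
     (\<forall>i\<in>A. \<forall>j\<in>A. (\<Sum>k\<in>A. S i k * precision \<Gamma> A k j) = (if i = j then 1 else 0))"
  using acyclic empty_subsetI[of A] assms(2)
proof (induction A rule: parent_closed_induct)
  case base
  then show ?case by simp
next
  case (step A v)
  have anc: "parents D w \<subseteq> A" if "w \<in> A" for w using step that by blast
  have v: "v \<notin> A" using step by blast
  have pa: "parents D v \<subseteq> A" using step by blast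
  from step obtain S where
    sym: "\<And>i j. i \<in> A \<Longrightarrow> j \<in> A \<Longrightarrow> S i j = S j i" and
    agree: "\<And>i j. i \<in> A \<Longrightarrow> j \<in> A \<Longrightarrow> {i, j} \<in> E \<Longrightarrow> S i j = \<Gamma> {i, j}" and
    inv: "\<And>i j. i \<in> A \<Longrightarrow> j \<in> A \<Longrightarrow> (\<Sum>k\<in>A. S i k * precision \<Gamma> A k j) = (if i = j then 1 else 0)"
    by blast
  define P where "P = parents D v"
  define b where "b = regression_coeffs P (edge_matrix \<Gamma>) v"
  define u where "u = cond_var \<Gamma> v"
  define w where "w = residual \<Gamma> v"
  define l where "l j = (\<Sum>p\<in>P. b p * S p j)" for j
  define S' where "S' i j = (if i = v then if j = v then \<Gamma> {v} else l j else if j = v then l i else S i j)" for i j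
  have PA: "P \<subseteq> A" using pa unfolding P_def .
  have vP: "v \<notin> P" unfolding P_def by (rule not_parent)
  have b: "(\<Sum>p\<in>P. \<Gamma> {q, p} * b p) = \<Gamma> {q, v}" if "q \<in> P" for q
    unfolding b_def P_def by (rule regression_coeffs[OF pos_def_parents[OF \<Gamma>]]) (use that P_def in simp)
  have l: "l q = \<Gamma> {q, v}" if "q \<in> P" for q
  proof -
    have "l q = (\<Sum>p\<in>P. \<Gamma> {q, p} * b p)"
      unfolding l_def
    proof (rule sum.cong[OF refl])
      fix p assume p: "p \<in> P"
      have "{p, q} \<in> E" using complete_parents[of v] p that unfolding complete_in_def P_def by blast
      then have "S p q = \<Gamma> {q, p}" using agree[of p q] p that PA by (auto simp: insert_commute)
      then show "b p * S p q = \<Gamma> {q, p} * b p" by simp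
    qed
    then show ?thesis using b[OF that] by simp
  qed
  have u: "u = \<Gamma> {v} - (\<Sum>p\<in>P. b p * \<Gamma> {p, v})"
    unfolding u_def cond_var_def residual_variance_def b_def P_def by simp
  have "u > 0" unfolding u_def by (rule cond_var_pos[OF \<Gamma>])
  have wv: "w v = 1" unfolding w_def residual_def by simp
  have wP: "w p = - b p" if "p \<in> P" for p
    using that vP unfolding w_def residual_def b_def P_def by auto
  have wO: "w p = 0" if "p \<notin> P" "p \<noteq> v" for p
    using that unfolding w_def residual_def P_def by auto
  have Sw: "(\<Sum>k\<in>insert v A. S' i k * w k) = (if i = v then u else 0)" if i: "i \<in> insert v A" for i
  proof -
    have "(\<Sum>k\<in>insert v A. S' i k * w k) = S' i v + (\<Sum>k\<in>A. S' i k * w k)"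
      using v by (simp add: wv)
    also have "(\<Sum>k\<in>A. S' i k * w k) = (\<Sum>k\<in>P. S' i k * w k)"
    proof (rule sum.mono_neutral_right)
      show "\<forall>k\<in>A - P. S' i k * w k = 0"
      proof
        fix k assume "k \<in> A - P"
        then have "w k = 0" using v by (intro wO) auto
        then show "S' i k * w k = 0" by simp
      qed
    qed (use PA in simp_all)
    also have "\<dots> = - (\<Sum>k\<in>P. b k * S' i k)"
      unfolding sum_negf[symmetric] by (intro sum.cong refl) (simp add: wP)
    also have "S' i v + - (\<Sum>k\<in>P. b k * S' i k) = (if i = v then u else 0)"
    proof (cases "i = v")
      case True
      have "(\<Sum>k\<in>P. b k * S' v k) = (\<Sum>k\<in>P. b k * \<Gamma> {k, v})"
        using vP by (intro sum.cong refl) (auto simp: S'_def l)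
      then show ?thesis unfolding True u by (simp add: S'_def)
    next
      case False
      then have iA: "i \<in> A" using i by simp
      have "(\<Sum>k\<in>P. b k * S' i k) = l i"
        unfolding l_def
      proof (rule sum.cong[OF refl])
        fix k assume k: "k \<in> P"
        have "k \<noteq> v" "k \<in> A" using k vP PA by blast+
        then show "b k * S' i k = b k * S k i" using False sym[OF iA, of k] by (simp add: S'_def)
      qed
      then show ?thesis using False by (simp add: S'_def)
    qed
    finally show ?thesis .
  qed
  have prec: "precision \<Gamma> (insert v A) k j = precision \<Gamma> A k j + w k * w j / u" for k j
    using v unfolding precision_def w_def u_def by simp
  have prec_v: "precision \<Gamma> A k j = 0" if "k = v \<or> j = v" for k j
    unfolding precision_def
  proof (rule sum.neutral, rule ballI)
    fix x assume "x \<in> A"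
    then have "v \<notin> family D x" using anc[of x] v unfolding family_def by blast
    then show "residual \<Gamma> x k * residual \<Gamma> x j / cond_var \<Gamma> x = 0"
      using that residual_outside[of v x] by auto
  qed
  have inv': "(\<Sum>k\<in>insert v A. S' i k * precision \<Gamma> (insert v A) k j) = (if i = j then 1 else 0)"
    if i: "i \<in> insert v A" and j: "j \<in> insert v A" for i j
  proof -
    have "(\<Sum>k\<in>insert v A. S' i k * precision \<Gamma> (insert v A) k j) =
       (\<Sum>k\<in>insert v A. S' i k * precision \<Gamma> A k j) + (\<Sum>k\<in>insert v A. S' i k * w k) * (w j / u)"
      unfolding prec by (simp add: distrib_left sum.distrib sum_distrib_right sum_divide_distrib mult.assoc del: sum.insert)
    also have "(\<Sum>k\<in>insert v A. S' i k * precision \<Gamma> A k j) = (\<Sum>k\<in>A. S' i k * precision \<Gamma> A k j)"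
      using v by (simp add: prec_v)
    also have "(\<Sum>k\<in>insert v A. S' i k * w k) = (if i = v then u else 0)" by (rule Sw[OF i])
    also have "(\<Sum>k\<in>A. S' i k * precision \<Gamma> A k j) + (if i = v then u else 0) * (w j / u) = (if i = j then 1 else 0)"
    proof (cases "i = v")
      case False
      then have iA: "i \<in> A" using i by simp
      have "(\<Sum>k\<in>A. S' i k * precision \<Gamma> A k j) = (\<Sum>k\<in>A. S i k * precision \<Gamma> A k j)"
        by (intro sum.cong refl) (use False v in \<open>auto simp: S'_def\<close>)
      also have "\<dots> = (if i = j then 1 else 0)"
      proof (cases "j = v")
        case True
        then show ?thesis using False by (simp add: prec_v)
      next
        case False
        then show ?thesis using j inv[OF iA, of j] by simp
      qed
      finally show ?thesis using False by simp
    next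
      case True
      have "(\<Sum>k\<in>A. S' i k * precision \<Gamma> A k j) = (\<Sum>k\<in>A. \<Sum>p\<in>P. b p * (S p k * precision \<Gamma> A k j))"
        using v True by (intro sum.cong refl) (auto simp: S'_def l_def sum_distrib_right mult.assoc)
      also have "\<dots> = (\<Sum>p\<in>P. \<Sum>k\<in>A. b p * (S p k * precision \<Gamma> A k j))" by (rule sum.swap)
      also have "\<dots> = (\<Sum>p\<in>P. b p * (\<Sum>k\<in>A. S p k * precision \<Gamma> A k j))"
        by (simp add: sum_distrib_left)
      finally have 1: "(\<Sum>k\<in>A. S' i k * precision \<Gamma> A k j) = (\<Sum>p\<in>P. b p * (\<Sum>k\<in>A. S p k * precision \<Gamma> A k j))" .
      show ?thesis
      proof (cases "j = v")
        case jv: True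
        then show ?thesis unfolding 1 using True \<open>u > 0\<close> by (simp add: prec_v wv)
      next
        case jv: False
        then have jA: "j \<in> A" using j by simp
        have "(\<Sum>p\<in>P. b p * (\<Sum>k\<in>A. S p k * precision \<Gamma> A k j)) = (\<Sum>p\<in>P. if p = j then b p else 0)"
        proof (rule sum.cong[OF refl])
          fix p assume "p \<in> P"
          then have "p \<in> A" using PA by blast
          show "b p * (\<Sum>k\<in>A. S p k * precision \<Gamma> A k j) = (if p = j then b p else 0)"
            unfolding inv[OF \<open>p \<in> A\<close> jA] by simp
        qed
        also have "\<dots> = (if j \<in> P then b j else 0)" by simp
        also have "\<dots> = - w j" using jv wP[of j] wO[of j] by auto
        finally show ?thesis unfolding 1 using True jv \<open>u > 0\<close> by simp
      qed
    qed
    finally show ?thesis .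
  qed
  have sym': "S' i j = S' j i" if "i \<in> insert v A" "j \<in> insert v A" for i j
    using that sym[of i j] by (auto simp: S'_def)
  have agree': "S' i j = \<Gamma> {i, j}" if i: "i \<in> insert v A" and j: "j \<in> insert v A" and e: "{i, j} \<in> E" for i j
  proof -
    have new: "l k = \<Gamma> {k, v}" if "k \<in> A" "{k, v} \<in> E" for k
    proof -
      have "v \<notin> parents D k" using anc[OF that(1)] v by blast
      then have "k \<in> P" using edge_cases[OF that(2)] that(1) v unfolding P_def by blast
      then show ?thesis by (rule l)
    qed
    consider "i = v" "j = v" | "i = v" "j \<in> A" "j \<noteq> v" | "i \<in> A" "i \<noteq> v" "j = v" | "i \<in> A" "j \<in> A" "i \<noteq> v" "j \<noteq> v"
      using i j v by blast
    then show ?thesis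
    proof cases
      case 1
      then show ?thesis by (simp add: S'_def)
    next
      case 2
      then show ?thesis using new[of j] e by (simp add: S'_def insert_commute)
    next
      case 3
      then show ?thesis using new[of i] e by (simp add: S'_def)
    next
      case 4
      then show ?thesis using agree[of i j] e by (simp add: S'_def)
    qed
  qed
  show ?case
    by (intro exI[of _ S'] conjI ballI impI) (fact sym' agree' inv')+
qed

text \<open>The matrix that is built vertex by vertex is positive definite because its inverse is a positive
  combination of squares with trivial common kernel. As its inverse is of this form, it can
  be compared with any other completion by \<open>completion_unique_aux\<close>.\<close>

lemma completion_properties:
  assumes \<Gamma>: "\<Gamma> \<in> Q_G E"
  shows completion_on_edges: "{i, j} \<in> E \<Longrightarrow> completion E \<Gamma> $ i $ j = \<Gamma> {i, j}"
    and matrix_inv_completion: "matrix_inv (completion E \<Gamma>) = (\<chi> i j. precision \<Gamma> UNIV i j)"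
proof -
  obtain S0 where
    S0: "\<And>i j. S0 i j = S0 j i" "\<And>i j. {i, j} \<in> E \<Longrightarrow> S0 i j = \<Gamma> {i, j}"
      "\<And>i j. (\<Sum>k\<in>UNIV. S0 i k * precision \<Gamma> UNIV k j) = (if i = j then 1 else 0)"
    using partial_completion[OF \<Gamma>, of UNIV] by auto
  define S where "S = (\<chi> i j. S0 i j)"
  define K where "K = (\<chi> i j. precision \<Gamma> UNIV i j)"
  have SK: "S ** K = mat 1"
    unfolding S_def K_def matrix_matrix_mult_def mat_def by (simp add: vec_eq_iff S0(3))
  have KS: "K ** S = mat 1" by (rule matrix_left_right_inverse1[OF SK])
  have uniq_inv: "matrix_inv A = B" if "A ** B = mat 1" for A B :: "real ^ 'v ^ 'v"
  proof -
    have BA: "B ** A = mat 1" by (rule matrix_left_right_inverse1[OF that])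
    have "A ** matrix_inv A = mat 1 \<and> matrix_inv A ** A = mat 1"
      unfolding matrix_inv_def by (rule someI[of _ B]) (simp add: that BA)
    then have "B ** A ** matrix_inv A = B" by (simp add: matrix_mul_assoc[symmetric])
    then show ?thesis unfolding BA by simp
  qed
  have invS: "matrix_inv S = K" by (rule uniq_inv[OF SK])
  have K: "K $ i $ j = (\<Sum>v\<in>UNIV. residual \<Gamma> v i * residual \<Gamma> v j / cond_var \<Gamma> v)" for i j
    unfolding K_def precision_def by simp
  have pd: "pos_def_on UNIV (\<lambda>i j. S $ i $ j)"
    unfolding pos_def_on_def
  proof (intro conjI allI impI)
    show "\<forall>i\<in>UNIV. \<forall>j\<in>UNIV. S $ i $ j = S $ j $ i" using S0(1) by (simp add: S_def)
    fix x :: "'v \<Rightarrow> real" assume ex: "\<exists>i\<in>UNIV. x i \<noteq> 0"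
    define y where "y = S *v (\<chi> i. x i)"
    define t where "t v = (\<Sum>i\<in>UNIV. residual \<Gamma> v i * y $ i)" for v
    have Ky: "K *v y = (\<chi> i. x i)" unfolding y_def by (simp add: matrix_vector_mul_assoc KS)
    have Ky': "(K *v y) $ i = (\<Sum>v\<in>UNIV. residual \<Gamma> v i * t v / cond_var \<Gamma> v)" for i
    proof -
      have "(K *v y) $ i = (\<Sum>j\<in>UNIV. \<Sum>v\<in>UNIV. residual \<Gamma> v i * (residual \<Gamma> v j * y $ j) / cond_var \<Gamma> v)"
        by (simp add: matrix_vector_mult_def K sum_distrib_right mult.assoc)
      also have "\<dots> = (\<Sum>v\<in>UNIV. \<Sum>j\<in>UNIV. residual \<Gamma> v i * (residual \<Gamma> v j * y $ j) / cond_var \<Gamma> v)"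
        by (rule sum.swap)
      also have "\<dots> = (\<Sum>v\<in>UNIV. residual \<Gamma> v i * t v / cond_var \<Gamma> v)"
        by (simp add: t_def sum_distrib_left sum_divide_distrib)
      finally show ?thesis .
    qed
    have "(\<Sum>i\<in>UNIV. \<Sum>j\<in>UNIV. x i * S $ i $ j * x j) = (\<Sum>i\<in>UNIV. x i * y $ i)"
      unfolding y_def matrix_vector_mult_def by (simp add: sum_distrib_left mult.assoc)
    also have "\<dots> = (\<Sum>i\<in>UNIV. (K *v y) $ i * y $ i)" unfolding Ky by simp
    also have "\<dots> = (\<Sum>i\<in>UNIV. \<Sum>v\<in>UNIV. (residual \<Gamma> v i * y $ i) * t v / cond_var \<Gamma> v)"
      unfolding Ky' by (simp add: sum_distrib_left sum_distrib_right mult_ac)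
    also have "\<dots> = (\<Sum>v\<in>UNIV. \<Sum>i\<in>UNIV. (residual \<Gamma> v i * y $ i) * t v / cond_var \<Gamma> v)"
      by (rule sum.swap)
    also have "\<dots> = (\<Sum>v\<in>UNIV. (t v)\<^sup>2 / cond_var \<Gamma> v)"
      unfolding sum_divide_distrib[symmetric] sum_distrib_right[symmetric] t_def[symmetric]
      by (simp add: power2_eq_square)
    finally have eq: "(\<Sum>i\<in>UNIV. \<Sum>j\<in>UNIV. x i * S $ i $ j * x j) = (\<Sum>v\<in>UNIV. (t v)\<^sup>2 / cond_var \<Gamma> v)" .
    have nonneg: "(t v)\<^sup>2 / cond_var \<Gamma> v \<ge> 0" for v
      using cond_var_pos[OF \<Gamma>, of v] by simp
    have "(\<Sum>v\<in>UNIV. (t v)\<^sup>2 / cond_var \<Gamma> v) \<noteq> 0"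
    proof
      assume "(\<Sum>v\<in>UNIV. (t v)\<^sup>2 / cond_var \<Gamma> v) = 0"
      then have *: "\<forall>v\<in>UNIV. (t v)\<^sup>2 / cond_var \<Gamma> v = 0"
        by (subst (asm) sum_nonneg_eq_0_iff) (use nonneg in auto)
      have "t v = 0" for v using bspec[OF * UNIV_I, of v] cond_var_pos[OF \<Gamma>, of v] by simp
      then have "(K *v y) $ i = 0" for i unfolding Ky' by simp
      then have "x i = 0" for i unfolding Ky by simp
      then show False using ex by blast
    qed
    moreover have "(\<Sum>v\<in>UNIV. (t v)\<^sup>2 / cond_var \<Gamma> v) \<ge> 0" by (rule sum_nonneg) (rule nonneg)
    ultimately show "(\<Sum>i\<in>UNIV. \<Sum>j\<in>UNIV. x i * S $ i $ j * x j) > 0" unfolding eq by simp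
  qed
  have "completion E \<Gamma> = S"
    unfolding completion_def
  proof (rule the_equality)
    show "S \<in> PD_G E \<and> (\<forall>i j. {i, j} \<in> E \<longrightarrow> S $ i $ j = \<Gamma> {i, j})"
    proof -
      have "K $ i $ j = 0" if "{i, j} \<notin> E" for i j
        unfolding K_def using precision_off_edges[OF that] by simp
      moreover have "S $ i $ j = \<Gamma> {i, j}" if "{i, j} \<in> E" for i j
        unfolding S_def using S0(2)[OF that] by simp
      ultimately show ?thesis unfolding PD_G_def mem_Collect_eq invS using pd by blast
    qed
  next
    fix S2 assume S2: "S2 \<in> PD_G E \<and> (\<forall>i j. {i, j} \<in> E \<longrightarrow> S2 $ i $ j = \<Gamma> {i, j})"
    then have pd2: "pos_def_on UNIV (\<lambda>i j. S2 $ i $ j)" and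
      off2: "\<And>i j. {i, j} \<notin> E \<Longrightarrow> matrix_inv S2 $ i $ j = 0"
      unfolding PD_G_def by simp_all
    have "\<exists>B. B ** S2 = mat 1"
      unfolding matrix_left_invertible_ker
    proof (intro allI impI, rule ccontr)
      fix x assume "S2 *v x = 0" "x \<noteq> 0"
      then have "\<exists>i\<in>UNIV. x $ i \<noteq> 0" by (simp add: vec_eq_iff)
      then have "(\<Sum>i\<in>UNIV. \<Sum>j\<in>UNIV. x $ i * S2 $ i $ j * x $ j) > 0"
        using pd2 unfolding pos_def_on_def by blast
      moreover have "(\<Sum>i\<in>UNIV. \<Sum>j\<in>UNIV. x $ i * S2 $ i $ j * x $ j) = (\<Sum>i\<in>UNIV. x $ i * (S2 *v x) $ i)"
        by (simp add: matrix_vector_mult_def sum_distrib_left mult.assoc)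
      ultimately show False using \<open>S2 *v x = 0\<close> by simp
    qed
    then obtain B where "B ** S2 = mat 1" by blast
    then have SB: "S2 ** B = mat 1" by (rule matrix_left_right_inverse1)
    then have SK2: "S2 ** matrix_inv S2 = mat 1" using uniq_inv[OF SB] by simp
    have "S = S2"
    proof (rule completion_unique_aux[where E = E and w = "residual \<Gamma>" and u = "cond_var \<Gamma>", OF SK SK2 _ _ pd2 K])
      show "S $ i $ j = S $ j $ i" for i j using S0(1) by (simp add: S_def)
      show "S2 $ i $ j = S2 $ j $ i" for i j using pd2 unfolding pos_def_on_def by blast
      show "cond_var \<Gamma> v > 0" for v by (rule cond_var_pos[OF \<Gamma>])
      show "S $ i $ j = S2 $ i $ j" if "{i, j} \<in> E" for i j
        using that S2 S0(2) by (simp add: S_def)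
      show "K $ i $ j = matrix_inv S2 $ i $ j" if "{i, j} \<notin> E" for i j
        using that off2 by (simp add: K_def precision_off_edges)
    qed
    then show "S2 = S" by simp
  qed
  then show "{i, j} \<in> E \<Longrightarrow> completion E \<Gamma> $ i $ j = \<Gamma> {i, j}"
    and "matrix_inv (completion E \<Gamma>) = (\<chi> i j. precision \<Gamma> UNIV i j)"
    using S0(2) invS by (simp_all add: S_def K_def)
qed

text \<open>The inverse of the completion of \<open>U\<close> is a sum of squares of forms supported on families, and on a
  family the completion of \<open>\<Gamma>\<close> agrees with \<open>\<Gamma>\<close>.\<close>

lemma trace_completion:
  assumes \<Gamma>: "\<Gamma> \<in> Q_G E" and U: "U \<in> Q_G E"
  shows "trace (completion E \<Gamma> ** matrix_inv (completion E U)) =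
    (\<Sum>v\<in>UNIV. 1 / cond_var U v * (\<Sum>i\<in>family D v. \<Sum>j\<in>family D v. residual U v i * \<Gamma> {i, j} * residual U v j))"
proof -
  have "trace (completion E \<Gamma> ** matrix_inv (completion E U)) =
     (\<Sum>i\<in>UNIV. \<Sum>j\<in>UNIV. \<Sum>v\<in>UNIV. 1 / cond_var U v * (residual U v i * completion E \<Gamma> $ i $ j * residual U v j))"
    unfolding trace_def matrix_inv_completion[OF U] matrix_matrix_mult_def precision_def
    by (simp add: sum_distrib_left mult_ac)
  also have "\<dots> = (\<Sum>i\<in>UNIV. \<Sum>v\<in>UNIV. \<Sum>j\<in>UNIV. 1 / cond_var U v * (residual U v i * completion E \<Gamma> $ i $ j * residual U v j))"
    by (rule sum.cong[OF refl]) (rule sum.swap)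
  also have "\<dots> = (\<Sum>v\<in>UNIV. \<Sum>i\<in>UNIV. \<Sum>j\<in>UNIV. 1 / cond_var U v * (residual U v i * completion E \<Gamma> $ i $ j * residual U v j))"
    by (rule sum.swap)
  also have "\<dots> = (\<Sum>v\<in>UNIV. 1 / cond_var U v * (\<Sum>i\<in>family D v. \<Sum>j\<in>family D v. residual U v i * \<Gamma> {i, j} * residual U v j))"
  proof (rule sum.cong[OF refl])
    fix v
    have "(\<Sum>i\<in>UNIV. \<Sum>j\<in>UNIV. residual U v i * completion E \<Gamma> $ i $ j * residual U v j) =
      (\<Sum>i\<in>family D v. \<Sum>j\<in>UNIV. residual U v i * completion E \<Gamma> $ i $ j * residual U v j)"
      by (rule sum.mono_neutral_right) (auto simp: residual_outside)
    also have "\<dots> = (\<Sum>i\<in>family D v. \<Sum>j\<in>family D v. residual U v i * completion E \<Gamma> $ i $ j * residual U v j)"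
      by (intro sum.cong refl sum.mono_neutral_right) (auto simp: residual_outside)
    also have "\<dots> = (\<Sum>i\<in>family D v. \<Sum>j\<in>family D v. residual U v i * \<Gamma> {i, j} * residual U v j)"
    proof (intro sum.cong refl)
      fix i j assume "i \<in> family D v" "j \<in> family D v"
      then have "{i, j} \<in> E" using complete_family[of v] unfolding complete_in_def by blast
      then show "residual U v i * completion E \<Gamma> $ i $ j * residual U v j = residual U v i * \<Gamma> {i, j} * residual U v j"
        using completion_on_edges[OF \<Gamma>] by simp
    qed
    finally show "(\<Sum>i\<in>UNIV. \<Sum>j\<in>UNIV. 1 / cond_var U v * (residual U v i * completion E \<Gamma> $ i $ j * residual U v j)) =
      1 / cond_var U v * (\<Sum>i\<in>family D v. \<Sum>j\<in>family D v. residual U v i * \<Gamma> {i, j} * residual U v j)"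
      by (simp only: sum_distrib_left[symmetric])
  qed
  finally show ?thesis .
qed

end

section \<open>Integration of one vertex after the other\<close>

definition edges_in :: "'v set set \<Rightarrow> 'v set \<Rightarrow> 'v set set" where
  "edges_in E A = {e \<in> E. e \<subseteq> A}"

lemma borel_measurable_det_on:
  fixes A :: "'v::finite set"
  assumes "\<And>i j. i \<in> A \<Longrightarrow> j \<in> A \<Longrightarrow> {i, j} \<in> I"
  shows "(\<lambda>\<Gamma>. det_on A (edge_matrix \<Gamma>)) \<in> borel_measurable (\<Pi>\<^sub>M e\<in>I. lborel)"
  unfolding det_on_def
proof (intro borel_measurable_sum borel_measurable_times borel_measurable_const borel_measurable_prod)
  fix p i assume "p \<in> {p. p permutes A}" "i \<in> A"
  then have "p i \<in> A" using permutes_in_image[of p A i] by simp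
  then show "(\<lambda>\<Gamma>. \<Gamma> {i, p i}) \<in> borel_measurable (\<Pi>\<^sub>M e\<in>I. lborel)"
    using \<open>i \<in> A\<close> by (simp add: borel_measurable_component assms)
qed

lemma pred_pos_def_on:
  fixes A :: "'v::finite set"
  assumes "\<And>i j. i \<in> A \<Longrightarrow> j \<in> A \<Longrightarrow> {i, j} \<in> I"
  shows "Measurable.pred (\<Pi>\<^sub>M e\<in>I. (lborel :: real measure)) (\<lambda>\<Gamma>. pos_def_on A (edge_matrix \<Gamma>))"
proof -
  have "Measurable.pred (\<Pi>\<^sub>M e\<in>I. (lborel :: real measure)) (\<lambda>\<Gamma>. \<forall>B\<in>Pow A. 0 < det_on B (edge_matrix \<Gamma>))"
  proof (rule pred_intros_finite(3))
    fix B assume "B \<in> Pow A"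
    then have "(\<lambda>\<Gamma>. det_on B (edge_matrix \<Gamma>)) \<in> borel_measurable (\<Pi>\<^sub>M e\<in>I. lborel)"
      by (intro borel_measurable_det_on assms) auto
    then show "Measurable.pred (\<Pi>\<^sub>M e\<in>I. (lborel :: real measure)) (\<lambda>\<Gamma>. 0 < det_on B (edge_matrix \<Gamma>))"
      by measurable
  qed simp
  moreover have "pos_def_on A (edge_matrix \<Gamma>) \<longleftrightarrow> (\<forall>B\<in>Pow A. 0 < det_on B (edge_matrix \<Gamma>))" for \<Gamma>
    using pos_def_on_iff_det_on[of A "edge_matrix \<Gamma>"] edge_matrix_sym[of \<Gamma>] by blast
  ultimately show ?thesis by simp
qed

context perfect_dag
begin

definition energy :: "('v \<Rightarrow> 'v \<Rightarrow> real) \<Rightarrow> 'v \<Rightarrow> ('v set \<Rightarrow> real) \<Rightarrow> real" where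
  "energy w v \<Gamma> = (\<Sum>i\<in>family D v. \<Sum>j\<in>family D v. w v i * \<Gamma> {i, j} * w v j)"

definition det_ratio :: "'v \<Rightarrow> ('v set \<Rightarrow> real) \<Rightarrow> real" where
  "det_ratio v \<Gamma> = det_on (family D v) (edge_matrix \<Gamma>) / det_on (parents D v) (edge_matrix \<Gamma>)"

text \<open>The factor of the vertex \<open>v\<close> in the density; it depends only on the entries within its family.\<close>

definition factor ::
  "('v \<Rightarrow> real) \<Rightarrow> ('v \<Rightarrow> 'v \<Rightarrow> real) \<Rightarrow> ('v \<Rightarrow> real) \<Rightarrow> 'v \<Rightarrow> ('v set \<Rightarrow> real) \<Rightarrow> ennreal" where
  "factor h w e v \<Gamma> = (if pos_def_on (family D v) (edge_matrix \<Gamma>)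
     then ennreal (exp (- h v * energy w v \<Gamma>) * det_ratio v \<Gamma> powr e v *
       det_on (parents D v) (edge_matrix \<Gamma>) powr (- 1 / 2))
     else 0)"

lemma borel_measurable_factor:
  assumes "\<And>i j. i \<in> family D v \<Longrightarrow> j \<in> family D v \<Longrightarrow> {i, j} \<in> I"
  shows "factor h w e v \<in> borel_measurable (\<Pi>\<^sub>M e\<in>I. lborel)"
proof -
  have [measurable]: "(\<lambda>\<Gamma>. det_on A (edge_matrix \<Gamma>)) \<in> borel_measurable (\<Pi>\<^sub>M e\<in>I. lborel)"
    if "A \<subseteq> family D v" for A
    using that by (intro borel_measurable_det_on assms) auto
  have [measurable]: "energy w v \<in> borel_measurable (\<Pi>\<^sub>M e\<in>I. lborel)"
    unfolding energy_def[abs_def]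
    by (intro borel_measurable_sum borel_measurable_times borel_measurable_const
        borel_measurable_component assms)
  have [simp]: "parents D v \<subseteq> family D v" unfolding family_def by blast
  have [measurable]: "Measurable.pred (\<Pi>\<^sub>M e\<in>I. (lborel :: real measure)) (\<lambda>\<Gamma>. pos_def_on (family D v) (edge_matrix \<Gamma>))"
    by (rule pred_pos_def_on) (rule assms)
  have "(\<lambda>\<Gamma>. exp (- h v * energy w v \<Gamma>) * det_ratio v \<Gamma> powr e v *
       det_on (parents D v) (edge_matrix \<Gamma>) powr (- 1 / 2)) \<in> borel_measurable (\<Pi>\<^sub>M e\<in>I. lborel)"
    unfolding det_ratio_def by measurable
  then show ?thesis unfolding factor_def[abs_def] by measurable
qed

lemma factor_cong:
  assumes "\<And>i j. i \<in> family D v \<Longrightarrow> j \<in> family D v \<Longrightarrow> \<Gamma> {i, j} = \<Gamma>' {i, j}"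
  shows "factor h w e v \<Gamma> = factor h w e v \<Gamma>'"
proof -
  have "pos_def_on (family D v) (edge_matrix \<Gamma>) = pos_def_on (family D v) (edge_matrix \<Gamma>')"
    by (rule pos_def_on_cong) (rule assms)
  moreover have "det_on A (edge_matrix \<Gamma>) = det_on A (edge_matrix \<Gamma>')" if "A \<subseteq> family D v" for A
    using that by (intro det_on_cong assms) auto
  then have "det_on (family D v) (edge_matrix \<Gamma>) = det_on (family D v) (edge_matrix \<Gamma>')"
    "det_on (parents D v) (edge_matrix \<Gamma>) = det_on (parents D v) (edge_matrix \<Gamma>')"
    by (auto simp: family_def)
  moreover have "energy w v \<Gamma> = energy w v \<Gamma>'"
    unfolding energy_def by (intro sum.cong refl) (simp add: assms)
  ultimately show ?thesis unfolding factor_def det_ratio_def by simp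
qed

text \<open>As \<open>A\<close> is closed under parents, an edge between \<open>v\<close> and \<open>A\<close> points to \<open>v\<close>.\<close>

lemma edges_in_insert:
  assumes "\<And>w. w \<in> A \<Longrightarrow> parents D w \<subseteq> A" "v \<notin> A" "parents D v \<subseteq> A"
  shows "edges_in E (insert v A) = edges_in E A \<union> (\<lambda>p. {v, p}) ` family D v"
    and "edges_in E A \<inter> (\<lambda>p. {v, p}) ` family D v = {}"
proof -
  show "edges_in E (insert v A) = edges_in E A \<union> (\<lambda>p. {v, p}) ` family D v"
  proof (intro equalityI subsetI)
    fix e assume "e \<in> edges_in E (insert v A)"
    then have e: "e \<in> E" "e \<subseteq> insert v A" unfolding edges_in_def by simp_all
    show "e \<in> edges_in E A \<union> (\<lambda>p. {v, p}) ` family D v"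
    proof (cases "v \<in> e")
      case False
      then have "e \<in> edges_in E A" using e unfolding edges_in_def by blast
      then show ?thesis by (rule UnI1)
    next
      case True
      obtain i j where "e = {i, j}" using e(1) undirected unfolding undirected_graph_def by blast
      then have "e = {v, i} \<or> e = {v, j}" using True by (metis empty_iff insert_commute insert_iff)
      then obtain p where p: "e = {v, p}" by blast
      have vp: "{v, p} \<in> E" "p \<in> insert v A" using e unfolding p by simp_all
      have "p \<in> family D v"
      proof (cases "p = v")
        case False
        then have "p \<in> A" using vp(2) by simp
        then have "v \<notin> parents D p" using assms(1,2) by blast
        then have "p \<in> parents D v" using edge_cases[OF vp(1)] False by simp
        then show ?thesis unfolding family_def by simp
      qed (simp add: family_def)
      then show ?thesis unfolding p by (intro UnI2 imageI)
    qed
  next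
    fix e assume "e \<in> edges_in E A \<union> (\<lambda>p. {v, p}) ` family D v"
    then show "e \<in> edges_in E (insert v A)"
    proof
      assume "e \<in> (\<lambda>p. {v, p}) ` family D v"
      then obtain p where p: "p \<in> family D v" "e = {v, p}" by blast
      have "{v, p} \<in> E"
        using p(1) complete_family[of v] unfolding complete_in_def family_def by blast
      moreover have "p \<in> insert v A" using p(1) assms(3) unfolding family_def by blast
      ultimately show ?thesis using p(2) unfolding edges_in_def by blast
    qed (auto simp: edges_in_def)
  qed
  show "edges_in E A \<inter> (\<lambda>p. {v, p}) ` family D v = {}"
    using assms(2) unfolding edges_in_def by blast
qed

lemma borel_measurable_factor_merge:
  assumes "\<And>i j. i \<in> family D v \<Longrightarrow> j \<in> family D v \<Longrightarrow> {i, j} \<in> I \<union> J"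
    and x: "x \<in> space (\<Pi>\<^sub>M e\<in>I. (lborel :: real measure))"
  shows "(\<lambda>y. factor h w e v (merge I J (x, y))) \<in> borel_measurable (\<Pi>\<^sub>M e\<in>J. lborel)"
proof (rule measurable_compose[OF _ borel_measurable_factor])
  show "(\<lambda>y. merge I J (x, y)) \<in> (\<Pi>\<^sub>M e\<in>J. lborel) \<rightarrow>\<^sub>M (\<Pi>\<^sub>M e\<in>I \<union> J. (lborel :: real measure))"
    by (rule measurable_compose[OF measurable_Pair1'[OF x] measurable_merge])
qed (rule assms)

text \<open>The bound does not depend on the entries \<open>x\<close> between the earlier vertices: the determinant of the
  parents in the factor cancels the one that the Gaussian integral produces.\<close>

lemma nn_integral_factor:
  assumes A: "\<And>w. w \<in> A \<Longrightarrow> parents D w \<subseteq> A" "v \<notin> A" "parents D v \<subseteq> A"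
    and h: "h v > 0" and w: "w v v = 1"
    and x: "x \<in> space (\<Pi>\<^sub>M e\<in>edges_in E A. (lborel :: real measure))"
  shows "(\<integral>\<^sup>+y. factor h w e v (merge (edges_in E A) ((\<lambda>p. {v, p}) ` family D v) (x, y))
      \<partial>(\<Pi>\<^sub>M e\<in>(\<lambda>p. {v, p}) ` family D v. lborel)) \<le>
    gamma_integral (h v) (e v) * ennreal (sqrt (pi / h v) ^ card (parents D v))"
proof -
  define J where "J = (\<lambda>p. {v, p}) ` family D v"
  define P where "P = parents D v"
  define N where "N y i j = (if i = v then y {v, j} else if j = v then y {v, i} else x {i, j})"
    for y :: "'v set \<Rightarrow> real" and i j
  have fam: "family D v = insert v P" unfolding family_def P_def ..
  have vP: "v \<notin> P" unfolding P_def by (rule not_parent)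
  have disj: "edges_in E A \<inter> J = {}" unfolding J_def by (rule edges_in_insert(2)[OF A])
  have inj: "inj_on (\<lambda>p. {v, p}) (insert v P)" by (auto simp: inj_on_def doubleton_eq_iff)
  have mN: "merge (edges_in E A) J (x, y) {i, j} = N y i j" if i: "i \<in> family D v" and j: "j \<in> family D v" for y i j
  proof -
    consider "i = v" | "i \<noteq> v" "j = v" | "i \<noteq> v" "j \<noteq> v" by blast
    then show ?thesis
    proof cases
      case 1
      then have "{i, j} \<in> J" using j unfolding J_def by blast
      then show ?thesis using disj 1 by (simp add: N_def)
    next
      case 2
      then have "{i, j} \<in> J" using i unfolding J_def by blast
      then show ?thesis using disj 2 by (simp add: N_def insert_commute)
    next
      case 3
      then have "{i, j} \<in> edges_in E A"
        using i j A(3) complete_family[of v] unfolding edges_in_def complete_in_def family_def by blast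
      then show ?thesis using disj 3 by (simp add: N_def)
    qed
  qed
  define c where "c = det_on P (edge_matrix x) powr (- 1 / 2)"
  have factor: "factor h w e v (merge (edges_in E A) J (x, y)) =
    (if pos_def_on (insert v P) (N y) then ennreal (exp (- h v * (\<Sum>i\<in>insert v P. \<Sum>j\<in>insert v P. w v i * N y i j * w v j)) *
      (det_on (insert v P) (N y) / det_on P (edge_matrix x)) powr e v) else 0) * ennreal c" for y
  proof -
    define \<Gamma> where "\<Gamma> = merge (edges_in E A) J (x, y)"
    have "pos_def_on (family D v) (edge_matrix \<Gamma>) = pos_def_on (insert v P) (N y)"
      unfolding fam[symmetric] \<Gamma>_def by (rule pos_def_on_cong) (rule mN)
    moreover have "det_on (family D v) (edge_matrix \<Gamma>) = det_on (insert v P) (N y)"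
      unfolding fam[symmetric] \<Gamma>_def by (rule det_on_cong) (rule mN)
    moreover have "det_on (parents D v) (edge_matrix \<Gamma>) = det_on P (edge_matrix x)"
      unfolding P_def[symmetric]
    proof (rule det_on_cong)
      fix i j assume "i \<in> P" "j \<in> P"
      then show "\<Gamma> {i, j} = x {i, j}" using mN[of i j y] vP unfolding \<Gamma>_def fam N_def by auto
    qed
    moreover have "energy w v \<Gamma> = (\<Sum>i\<in>insert v P. \<Sum>j\<in>insert v P. w v i * N y i j * w v j)"
      unfolding energy_def fam[symmetric] \<Gamma>_def by (intro sum.cong refl) (simp only: mN)
    ultimately show ?thesis
      unfolding factor_def \<Gamma>_def[symmetric] det_ratio_def c_def by (simp add: ennreal_mult'')
  qed
  have "(\<integral>\<^sup>+y. factor h w e v (merge (edges_in E A) J (x, y)) \<partial>(\<Pi>\<^sub>M e\<in>J. lborel)) \<le>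
    gamma_integral (h v) (e v) * ennreal (sqrt (pi / h v) ^ card P)"
  proof (cases "pos_def_on P (edge_matrix x)")
    case True
    note reg = nn_integral_regression[where M = "edge_matrix x" and A = P and a = v and f = "\<lambda>p. {v, p}"
      and h = "h v" and w = "w v" and e = "e v", OF vP True inj h w, folded N_def]
    have J: "(\<lambda>p. {v, p}) ` insert v P = J" unfolding J_def fam ..
    have det: "det_on P (edge_matrix x) > 0" by (rule det_on_pos[OF True])
    then have c: "sqrt (det_on P (edge_matrix x)) * c = 1" "c \<ge> 0"
      unfolding c_def by (simp_all add: powr_half_sqrt[symmetric] powr_add[symmetric])
    have meas: "(\<lambda>y. factor h w e v (merge (edges_in E A) J (x, y))) \<in> borel_measurable (\<Pi>\<^sub>M e\<in>J. lborel)"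
    proof (rule borel_measurable_factor_merge[OF _ x])
      fix i j assume "i \<in> family D v" "j \<in> family D v"
      then have "{i, j} \<in> edges_in E (insert v A)"
        using complete_family[of v] A(3) unfolding edges_in_def complete_in_def family_def by blast
      then show "{i, j} \<in> edges_in E A \<union> J" by (simp only: J_def edges_in_insert(1)[OF A])
    qed
    define s where "s = sqrt (det_on P (edge_matrix x))"
    have cs: "ennreal c * ennreal s = 1" "s \<ge> 0"
      using c det unfolding s_def by (simp_all add: ennreal_mult''[symmetric] mult.commute)
    have "gamma_integral (h v) (e v) * ennreal (sqrt (pi / h v) ^ card P * s) =
      (\<integral>\<^sup>+y. factor h w e v (merge (edges_in E A) J (x, y)) * ennreal s \<partial>(\<Pi>\<^sub>M e\<in>J. lborel))"
      unfolding s_def reg[unfolded J, symmetric] factor mult.assoc cs(1)[unfolded s_def] mult_1_right ..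
    also have "\<dots> = (\<integral>\<^sup>+y. factor h w e v (merge (edges_in E A) J (x, y)) \<partial>(\<Pi>\<^sub>M e\<in>J. lborel)) * ennreal s"
      by (rule nn_integral_multc[OF meas])
    finally have "(\<integral>\<^sup>+y. factor h w e v (merge (edges_in E A) J (x, y)) \<partial>(\<Pi>\<^sub>M e\<in>J. lborel)) * ennreal s =
      gamma_integral (h v) (e v) * ennreal (sqrt (pi / h v) ^ card P) * ennreal s"
      by (simp only: ennreal_mult''[OF cs(2)] mult.assoc)
    then have "(\<integral>\<^sup>+y. factor h w e v (merge (edges_in E A) J (x, y)) \<partial>(\<Pi>\<^sub>M e\<in>J. lborel)) * ennreal s * ennreal c =
      gamma_integral (h v) (e v) * ennreal (sqrt (pi / h v) ^ card P) * ennreal s * ennreal c"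
      by (rule arg_cong)
    then show ?thesis
      unfolding mult.assoc[of _ "ennreal s"] mult.commute[of "ennreal s"] cs(1) mult_1_right
      by (rule eq_refl)
  next
    case False
    have "\<not> pos_def_on (insert v P) (N y)" for y
    proof
      assume "pos_def_on (insert v P) (N y)"
      then have "pos_def_on P (N y)" by (rule pos_def_on_subset) auto
      moreover have "pos_def_on P (N y) = pos_def_on P (edge_matrix x)"
        by (rule pos_def_on_cong) (use vP in \<open>auto simp: N_def\<close>)
      ultimately show False using False by simp
    qed
    then show ?thesis unfolding factor by simp
  qed
  then show ?thesis unfolding J_def P_def .
qed

text \<open>A vertex that comes after all others in \<open>A\<close> occurs in its own factor only, so that its row can be
  integrated first.\<close>

lemma nn_integral_prod_factor_finite:
  assumes h: "\<And>v. h v > 0" and w: "\<And>v. w v v = 1" and e: "\<And>v. e v > -1"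
    and A: "\<forall>v\<in>A - {}. parents D v \<subseteq> A"
  shows "(\<integral>\<^sup>+\<Gamma>. (\<Prod>v\<in>A. factor h w e v \<Gamma>) \<partial>(\<Pi>\<^sub>M e\<in>edges_in E A. lborel)) < \<infinity>"
  using acyclic empty_subsetI[of A] A
proof (induction A rule: parent_closed_induct)
  case base
  interpret product_sigma_finite "\<lambda>_::'v set. lborel :: real measure" by standard
  have "edges_in E {} = {}"
    using undirected unfolding edges_in_def undirected_graph_def by blast
  then show ?case by (simp add: space_PiM_empty emeasure_PiM_empty)
next
  case (step A v)
  interpret product_sigma_finite "\<lambda>_::'v set. lborel :: real measure" by standard
  have anc: "parents D u \<subseteq> A" if "u \<in> A" for u using step that by blast
  have v: "v \<notin> A" and pa: "parents D v \<subseteq> A" using step by blast+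
  define I where "I = edges_in E A"
  define J where "J = (\<lambda>p. {v, p}) ` family D v"
  define K where "K = gamma_integral (h v) (e v) * ennreal (sqrt (pi / h v) ^ card (parents D v))"
  have IJ: "edges_in E (insert v A) = I \<union> J" "I \<inter> J = {}"
    unfolding I_def J_def by (rule edges_in_insert[OF anc v pa]; assumption)+
  have fam: "{i, j} \<in> edges_in E B" if "i \<in> family D u" "j \<in> family D u" "family D u \<subseteq> B" for i j u B
    using that complete_family[of u] unfolding edges_in_def complete_in_def by blast
  have famA: "family D u \<subseteq> A" if "u \<in> A" for u using anc[OF that] that unfolding family_def by blast
  have famv: "family D v \<subseteq> insert v A" using pa unfolding family_def by blast
  have meas: "(\<lambda>\<Gamma>. \<Prod>u\<in>B. factor h w e u \<Gamma>) \<in> borel_measurable (\<Pi>\<^sub>M e\<in>edges_in E B. lborel)"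
    if "\<And>u. u \<in> B \<Longrightarrow> family D u \<subseteq> B" for B
    by (intro borel_measurable_prod_ennreal borel_measurable_factor fam that)
  have "(\<integral>\<^sup>+\<Gamma>. (\<Prod>u\<in>insert v A. factor h w e u \<Gamma>) \<partial>(\<Pi>\<^sub>M e\<in>I \<union> J. lborel)) =
    (\<integral>\<^sup>+x. \<integral>\<^sup>+y. (\<Prod>u\<in>insert v A. factor h w e u (merge I J (x, y))) \<partial>(\<Pi>\<^sub>M e\<in>J. lborel) \<partial>(\<Pi>\<^sub>M e\<in>I. lborel))"
  proof (rule product_nn_integral_fold)
    have "(\<lambda>\<Gamma>. \<Prod>u\<in>insert v A. factor h w e u \<Gamma>) \<in> borel_measurable (\<Pi>\<^sub>M e\<in>edges_in E (insert v A). lborel)"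
      by (rule meas) (use famA famv in blast)
    then show "(\<lambda>\<Gamma>. \<Prod>u\<in>insert v A. factor h w e u \<Gamma>) \<in> borel_measurable (\<Pi>\<^sub>M e\<in>I \<union> J. lborel)"
      unfolding IJ(1) .
  qed (use IJ(2) in simp_all)
  also have "\<dots> \<le> (\<integral>\<^sup>+x. (\<Prod>u\<in>A. factor h w e u x) * K \<partial>(\<Pi>\<^sub>M e\<in>I. lborel))"
  proof (rule nn_integral_mono)
    fix x assume x: "x \<in> space (\<Pi>\<^sub>M e\<in>I. (lborel :: real measure))"
    have old: "factor h w e u (merge I J (x, y)) = factor h w e u x" if "u \<in> A" for u y
    proof (rule factor_cong)
      fix i j assume "i \<in> family D u" "j \<in> family D u"
      then have "{i, j} \<in> I" unfolding I_def using fam famA[OF that] by blast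
      then show "merge I J (x, y) {i, j} = x {i, j}" using IJ(2) by simp
    qed
    have "(\<integral>\<^sup>+y. (\<Prod>u\<in>insert v A. factor h w e u (merge I J (x, y))) \<partial>(\<Pi>\<^sub>M e\<in>J. lborel)) =
      (\<integral>\<^sup>+y. (\<Prod>u\<in>A. factor h w e u x) * factor h w e v (merge I J (x, y)) \<partial>(\<Pi>\<^sub>M e\<in>J. lborel))"
      using v by (simp add: old mult.commute)
    also have "\<dots> = (\<Prod>u\<in>A. factor h w e u x) * (\<integral>\<^sup>+y. factor h w e v (merge I J (x, y)) \<partial>(\<Pi>\<^sub>M e\<in>J. lborel))"
      by (intro nn_integral_cmult borel_measurable_factor_merge x)
        (use fam[OF _ _ famv] in \<open>simp only: IJ(1)\<close>)
    also have "\<dots> \<le> (\<Prod>u\<in>A. factor h w e u x) * K"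
      unfolding K_def I_def J_def
      by (intro mult_left_mono nn_integral_factor anc v pa h w x[unfolded I_def]) simp_all
    finally show "(\<integral>\<^sup>+y. (\<Prod>u\<in>insert v A. factor h w e u (merge I J (x, y))) \<partial>(\<Pi>\<^sub>M e\<in>J. lborel)) \<le>
      (\<Prod>u\<in>A. factor h w e u x) * K" .
  qed
  also have "\<dots> = (\<integral>\<^sup>+x. (\<Prod>u\<in>A. factor h w e u x) \<partial>(\<Pi>\<^sub>M e\<in>I. lborel)) * K"
    unfolding I_def by (rule nn_integral_multc) (rule meas, rule famA)
  also have "\<dots> < \<infinity>"
  proof -
    have "(\<integral>\<^sup>+x. (\<Prod>u\<in>A. factor h w e u x) \<partial>(\<Pi>\<^sub>M e\<in>I. lborel)) < \<infinity>"
      unfolding I_def using step by blast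
    moreover have "K < \<infinity>"
      unfolding K_def using gamma_integral_finite[OF h e] by (simp add: ennreal_mult_less_top)
    ultimately show ?thesis by (simp add: ennreal_mult_less_top)
  qed
  finally show ?case unfolding IJ(1) .
qed

end

section \<open>Perfect orders and determinants\<close>

context perfect_dag
begin

text \<open>In a complete set \<open>B\<close>, the vertices outside \<open>S\<close> can be removed one after the other, each time
  a vertex whose parents are all the others. Hence the determinant of \<open>B\<close> is that of \<open>S\<close> times the
  residual variances, and those of the parents of the removed vertices are intermediate products.\<close>

lemma ln_det_chain:
  assumes \<Gamma>: "\<Gamma> \<in> Q_G E" and B: "complete_in E B" "S \<subseteq> B"
    and pa: "\<And>v. v \<in> B - S \<Longrightarrow> parents D v \<subseteq> B" "\<And>v. v \<in> B - S \<Longrightarrow> S \<subseteq> parents D v"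
  shows "ln (det_on B (edge_matrix \<Gamma>)) = ln (det_on S (edge_matrix \<Gamma>)) + (\<Sum>v\<in>B - S. ln (det_ratio v \<Gamma>))"
    and "(\<Sum>v\<in>B - S. ln (det_on (parents D v) (edge_matrix \<Gamma>))) =
      real (card (B - S)) * ln (det_on S (edge_matrix \<Gamma>)) +
      (\<Sum>v\<in>B - S. (real (card B) - real (card (family D v))) * ln (det_ratio v \<Gamma>))"
proof -
  define L where "L A = ln (det_on A (edge_matrix \<Gamma>))" for A
  define l where "l v = ln (det_ratio v \<Gamma>)" for v
  have l: "l v = L (family D v) - L (parents D v)" for v
  proof -
    have "det_on (family D v) (edge_matrix \<Gamma>) > 0"
      by (rule det_on_pos[OF pos_def_family[OF \<Gamma>]])
    moreover have "det_on (parents D v) (edge_matrix \<Gamma>) > 0"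
      by (rule det_on_pos[OF pos_def_parents[OF \<Gamma>]])
    ultimately show ?thesis unfolding l_def L_def det_ratio_def by (simp add: ln_div)
  qed
  have closed: "\<forall>v\<in>B - S. parents D v \<subseteq> B" using pa(1) by blast
  have "L B = L S + (\<Sum>v\<in>B - S. l v) \<and> (\<Sum>v\<in>B - S. L (parents D v)) =
      real (card (B - S)) * L S + (\<Sum>v\<in>B - S. (real (card B) - real (card (family D v))) * l v)"
    using acyclic B(2) closed
  proof (induction B rule: parent_closed_induct)
    case base
    then show ?case by simp
  next
    case (step T v)
    have v: "v \<notin> T" "v \<in> B" "v \<notin> S" using step by blast+
    have "T \<subseteq> parents D v"
    proof
      fix x assume x: "x \<in> T"
      show "x \<in> parents D v"
      proof (cases "x \<in> S")
        case True
        then show ?thesis using pa(2)[of v] v by blast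
      next
        case False
        then have "v \<notin> parents D x" using step.hyps x v(1) by blast
        moreover have "{x, v} \<in> E" using B(1) x v(2) step.hyps unfolding complete_in_def by blast
        moreover have "x \<noteq> v" using x v(1) by blast
        ultimately show ?thesis using edge_cases[of x v] by blast
      qed
    qed
    then have pT: "parents D v = T" using step.hyps by blast
    then have fT: "family D v = insert v T" unfolding family_def by simp
    have IH1: "L T = L S + (\<Sum>v\<in>T - S. l v)" and IH2: "(\<Sum>v\<in>T - S. L (parents D v)) =
      real (card (T - S)) * L S + (\<Sum>v\<in>T - S. (real (card T) - real (card (family D v))) * l v)"
      using step.IH by blast+
    have ins: "insert v T - S = insert v (T - S)" using v by blast
    have vTS: "v \<notin> T - S" "finite (T - S)" using v by simp_all
    have 1: "L (insert v T) = L S + (\<Sum>v\<in>insert v T - S. l v)"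
      unfolding ins sum.insert[OF vTS(2,1)] using IH1 l[of v] unfolding pT fT by simp
    have card: "real (card (insert v T)) = real (card T) + 1" using v by simp
    have "(\<Sum>w\<in>insert v T - S. L (parents D w)) = L T + (\<Sum>w\<in>T - S. L (parents D w))"
      unfolding ins sum.insert[OF vTS(2,1)] pT ..
    also have "\<dots> = real (card (insert v T - S)) * L S +
      (\<Sum>w\<in>T - S. (real (card (insert v T)) - real (card (family D w))) * l w)"
      unfolding IH1 IH2 card unfolding ins using vTS
      by (simp add: sum.distrib[symmetric] algebra_simps)
    also have "\<dots> = real (card (insert v T - S)) * L S +
      (\<Sum>w\<in>insert v T - S. (real (card (insert v T)) - real (card (family D w))) * l w)"
      unfolding ins sum.insert[OF vTS(2,1)] fT by simp
    finally show ?case using 1 by blast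
  qed
  then show "ln (det_on B (edge_matrix \<Gamma>)) = ln (det_on S (edge_matrix \<Gamma>)) + (\<Sum>v\<in>B - S. ln (det_ratio v \<Gamma>))"
    and "(\<Sum>v\<in>B - S. ln (det_on (parents D v) (edge_matrix \<Gamma>))) =
      real (card (B - S)) * ln (det_on S (edge_matrix \<Gamma>)) +
      (\<Sum>v\<in>B - S. (real (card B) - real (card (family D v))) * ln (det_ratio v \<Gamma>))"
    unfolding L_def l_def by blast+
qed

end

locale induced_dag =
  fixes E :: "'v::finite set set" and r :: nat and C :: "nat \<Rightarrow> 'v set" and D :: "'v rel"
  assumes undirected_E: "undirected_graph E"
    and perfect: "perfect_order E r C"
    and dag_D: "dag_version E D"
    and induced: "induced_by D r C"
begin

lemma clique_C: "j \<in> {1..r} \<Longrightarrow> clique E (C j)"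
  using perfect unfolding perfect_order_def bij_betw_def by blast

lemma complete_C: "j \<in> {1..r} \<Longrightarrow> complete_in E (C j)"
  using clique_C unfolding clique_def by blast

lemma complete_sep: "j \<in> {1..r} \<Longrightarrow> complete_in E (sep C j)"
  by (rule complete_in_subset[OF complete_C]) (auto simp: sep_def)

lemma clique_index: "clique E A \<Longrightarrow> \<exists>j\<in>{1..r}. A = C j"
  using perfect unfolding perfect_order_def bij_betw_def by blast

lemma edge_in_clique:
  assumes "{i, j} \<in> E"
  shows "\<exists>k\<in>{1..r}. i \<in> C k \<and> j \<in> C k"
proof -
  have "{i} \<in> E" "{j} \<in> E" using undirected_E unfolding undirected_graph_def by blast+
  then have "complete_in E {i, j}"
    using assms unfolding complete_in_def by (auto simp: insert_commute)
  then obtain A where "clique E A" "{i, j} \<subseteq> A" by (rule complete_in_imp_clique)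
  then show ?thesis using clique_index[of A] by auto
qed

lemma subset_hist: "1 \<le> i \<Longrightarrow> i \<le> j \<Longrightarrow> C i \<subseteq> hist C j"
  unfolding hist_def by auto

lemma hist_mono: "i \<le> j \<Longrightarrow> hist C i \<subseteq> hist C j"
  unfolding hist_def by fastforce

lemma hist_r: "hist C r = UNIV"
proof -
  have "v \<in> hist C r" for v
  proof -
    have "{v, v} \<in> E" using undirected_E unfolding undirected_graph_def by simp
    then obtain k where "k \<in> {1..r}" "v \<in> C k" using edge_in_clique by blast
    then show ?thesis unfolding hist_def by blast
  qed
  then show ?thesis by blast
qed

lemma ancestral_hist:
  assumes "j \<le> r"
  shows "ancestral D (hist C j)"
proof -
  consider "j = 0" | "j \<in> {1..r - 1}" | "j = r" using assms by fastforce
  then show ?thesis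
  proof cases
    case 1
    then show ?thesis by (simp add: hist_def ancestral_def)
  next
    case 2
    then show ?thesis using induced unfolding induced_by_def by blast
  next
    case 3
    then show ?thesis by (simp add: hist_r ancestral_def)
  qed
qed

text \<open>The position of the clique in which a vertex is new.\<close>

definition first_index :: "'v \<Rightarrow> nat" where
  "first_index v = (LEAST j. v \<in> hist C j)"

lemma first_index_properties:
  shows first_index_range: "first_index v \<in> {1..r}"
    and first_index_eq_iff: "j \<in> {1..r} \<Longrightarrow> first_index v = j \<longleftrightarrow> v \<in> C j - sep C j"
proof -
  have r: "v \<in> hist C r" unfolding hist_r by simp
  have in_hist: "v \<in> hist C j \<longleftrightarrow> first_index v \<le> j" for j
  proof
    assume "first_index v \<le> j"
    moreover have "v \<in> hist C (first_index v)" unfolding first_index_def by (rule LeastI[where P = "\<lambda>j. v \<in> hist C j", OF r])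
    ultimately show "v \<in> hist C j" using hist_mono by blast
  qed (simp add: first_index_def Least_le)
  have "hist C 0 = {}" unfolding hist_def by simp
  then have "first_index v \<noteq> 0" using in_hist[of 0] by auto
  moreover have "first_index v \<le> r" using in_hist[of r] r by blast
  ultimately show "first_index v \<in> {1..r}" by simp
  assume j: "j \<in> {1..r}"
  then have "{1..j} = insert j {1..j - 1}" by auto
  then have "hist C j = C j \<union> hist C (j - 1)" unfolding hist_def by simp
  then have "v \<in> C j - sep C j \<longleftrightarrow> first_index v \<le> j \<and> \<not> first_index v \<le> j - 1"
    using in_hist[of j] in_hist[of "j - 1"] unfolding sep_def by blast
  then show "first_index v = j \<longleftrightarrow> v \<in> C j - sep C j" using j by auto
qed

lemma new_vertices: "j \<in> {1..r} \<Longrightarrow> {v \<in> UNIV. first_index v = j} = C j - sep C j"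
  using first_index_eq_iff by auto

text \<open>A neighbour \<open>w\<close> that is not later than the new vertex \<open>v\<close> of \<open>C j\<close> lies in \<open>C j\<close>: the first clique
  that contains both cannot come after \<open>C j\<close>, for then its separator would contain both.\<close>

lemma earlier_neighbour:
  assumes j: "j \<in> {1..r}" and v: "v \<in> C j - sep C j" and w: "w \<in> hist C j" and e: "{w, v} \<in> E"
  shows "w \<in> C j"
proof -
  define k where "k = (LEAST k. k \<in> {1..r} \<and> w \<in> C k \<and> v \<in> C k)"
  have k: "k \<in> {1..r} \<and> w \<in> C k \<and> v \<in> C k"
    unfolding k_def by (rule LeastI_ex) (use edge_in_clique[OF e] in blast)
  have "v \<notin> hist C (j - 1)" using v unfolding sep_def by blast
  then have "k \<ge> j" using k subset_hist[of k "j - 1"] by fastforce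
  moreover have "\<not> k > j"
  proof
    assume kj: "k > j"
    then have "hist C j \<subseteq> hist C (k - 1)" by (intro hist_mono) simp
    moreover have "v \<in> hist C j" using v j subset_hist[of j j] by auto
    ultimately have "w \<in> sep C k" "v \<in> sep C k" using w k unfolding sep_def by blast+
    moreover have "k \<in> {2..r}" using k kj j by auto
    ultimately obtain i where i: "i \<in> {1..<k}" "w \<in> C i" "v \<in> C i"
      using perfect unfolding perfect_order_def by blast
    have "i \<in> {1..r}" using i(1) k by simp
    then have "k \<le> i" unfolding k_def using i(2,3) by (intro Least_le) blast
    then show False using i(1) by simp
  qed
  ultimately show ?thesis using k by auto
qed

lemma parents_new:
  assumes j: "j \<in> {1..r}" and v: "v \<in> C j - sep C j"
  shows "parents D v \<subseteq> C j" and "sep C j \<subseteq> parents D v"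
proof -
  have irr: "(x, x) \<notin> D" for x using dag_D unfolding dag_version_def acyclic_def by blast
  show "parents D v \<subseteq> C j"
  proof
    fix w assume "w \<in> parents D v"
    then have wv: "(w, v) \<in> D" unfolding parents_def by simp
    have "v \<in> hist C j" using v j subset_hist[of j j] by auto
    then have "w \<in> hist C j" using ancestral_hist[of j] j wv unfolding ancestral_def by auto
    moreover have "w \<noteq> v" using wv irr by blast
    then have "{w, v} \<in> E" using dag_D wv unfolding dag_version_def by blast
    ultimately show "w \<in> C j" by (rule earlier_neighbour[OF j v])
  qed
  show "sep C j \<subseteq> parents D v"
  proof
    fix w assume w: "w \<in> sep C j"
    then have "w \<in> C j" "w \<noteq> v" using v unfolding sep_def by blast+
    then have "(w, v) \<in> D \<or> (v, w) \<in> D"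
      using complete_C[OF j] v dag_D unfolding complete_in_def dag_version_def by blast
    moreover have "(v, w) \<notin> D"
    proof
      assume "(v, w) \<in> D"
      moreover have "w \<in> hist C (j - 1)" using w unfolding sep_def by blast
      ultimately have "v \<in> hist C (j - 1)"
        using ancestral_hist[of "j - 1"] j unfolding ancestral_def by auto
      then show False using v unfolding sep_def by blast
    qed
    ultimately show "w \<in> parents D v" unfolding parents_def by blast
  qed
qed

sublocale perfect_dag E D
proof
  fix v
  have "v \<in> C (first_index v) - sep C (first_index v)"
    using first_index_eq_iff[OF first_index_range] by blast
  then show "complete_in E (parents D v)"
    by (intro complete_in_subset[OF complete_C[OF first_index_range[of v]]] parents_new(1) first_index_range)
qed (rule undirected_E dag_D)+

lemma H_G_eq_exp:
  assumes \<Gamma>: "\<Gamma> \<in> Q_G E"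
  shows "H_G r C a b \<Gamma> = exp ((\<Sum>i=1..r. a i * ln (det_on (C i) (edge_matrix \<Gamma>))) -
    (\<Sum>i=2..r. b i * ln (det_on (sep C i) (edge_matrix \<Gamma>))))"
proof -
  have "det_on (C i) (edge_matrix \<Gamma>) > 0" if "i \<in> {1..r}" for i
    by (intro det_on_pos Q_G_pos_def_on[OF \<Gamma>] complete_C that)
  then have 1: "(\<Prod>i=1..r. det_on (C i) (edge_matrix \<Gamma>) powr a i) = (\<Prod>i=1..r. exp (a i * ln (det_on (C i) (edge_matrix \<Gamma>))))"
    by (intro prod.cong refl) (simp add: powr_def less_imp_neq[symmetric])
  have "det_on (sep C i) (edge_matrix \<Gamma>) > 0" if "i \<in> {1..r}" for i
    by (intro det_on_pos Q_G_pos_def_on[OF \<Gamma>] complete_sep that)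
  then have 2: "(\<Prod>i=2..r. det_on (sep C i) (edge_matrix \<Gamma>) powr b i) = (\<Prod>i=2..r. exp (b i * ln (det_on (sep C i) (edge_matrix \<Gamma>))))"
    by (intro prod.cong refl) (simp add: powr_def less_imp_neq[symmetric])
  show ?thesis unfolding H_G_def 1 2 by (simp add: exp_diff exp_sum)
qed

text \<open>The exponent of the residual variance of \<open>v\<close> in the density. An ancestral separator that contains
  \<open>v\<close> contributes because its determinant is a product of residual variances.\<close>

definition exponent :: "(nat \<Rightarrow> real) \<Rightarrow> (nat \<Rightarrow> real) \<Rightarrow> 'v \<Rightarrow> real" where
  "exponent \<alpha> \<beta> v = \<alpha> (first_index v) - (real (card (family D v)) + 1) / 2 +
    (\<Sum>i | i \<in> {2..r} \<and> ancestral D (sep C i) \<and> v \<in> sep C i. \<alpha> i - \<beta> i)"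

text \<open>Put \<open>\<sigma>\<^sub>v\<close> for \<^term>\<open>det_ratio v \<Gamma>\<close>. The determinant of \<open>C\<^sub>i\<close> is that of \<open>S\<^sub>i\<close> times the \<open>\<sigma>\<^sub>v\<close> of the new
  vertices. This leaves the determinant of \<open>S\<^sub>i\<close> with the exponent \<open>\<alpha>\<^sub>i - \<beta>\<^sub>i - (c\<^sub>i - s\<^sub>i) / 2\<close>. The determinants
  of the parents of the new vertices, to the power \<open>-1/2\<close>, absorb the part \<open>(c\<^sub>i - s\<^sub>i) / 2\<close> of it,
  at the price of a shift in the exponents of the \<open>\<sigma>\<^sub>v\<close>. The rest is zero by assumption unless \<open>S\<^sub>i\<close> is ancestral, and then the determinant of \<open>S\<^sub>i\<close> is the product
  of the \<open>\<sigma>\<^sub>v\<close> of its elements.\<close>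

lemma H_G_factorization:
  assumes \<Gamma>: "\<Gamma> \<in> Q_G E"
    and eq: "\<And>i. i \<in> {2..r} \<Longrightarrow> \<not> ancestral D (sep C i) \<Longrightarrow> \<alpha> i = \<beta> i"
  shows "H_G r C (\<lambda>i. - (real (card (C i)) + 1) / 2) (\<lambda>i. - (real (card (sep C i)) + 1) / 2) \<Gamma> * H_G r C \<alpha> \<beta> \<Gamma> =
    (\<Prod>v\<in>UNIV. det_ratio v \<Gamma> powr exponent \<alpha> \<beta> v * det_on (parents D v) (edge_matrix \<Gamma>) powr (- 1 / 2))"
proof -
  define L where "L i = ln (det_on (C i) (edge_matrix \<Gamma>))" for i
  define M where "M i = ln (det_on (sep C i) (edge_matrix \<Gamma>))" for i
  define l where "l v = ln (det_ratio v \<Gamma>)" for v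
  define p where "p v = ln (det_on (parents D v) (edge_matrix \<Gamma>))" for v
  define c where "c i = real (card (C i))" for i
  define s where "s i = real (card (sep C i))" for i
  define f where "f v = real (card (family D v))" for v
  have "r \<ge> 1" using first_index_range[of undefined] by auto
  then have r1: "{1..r} = insert 1 {2..r}" by auto
  \<comment> \<open>The empty history makes the position \<open>1\<close> harmless, so that all sums can run over \<open>{1..r}\<close>.\<close>
  have "sep C 1 = {}" by (simp add: sep_def hist_def)
  then have M1: "M 1 = 0" by (simp add: M_def det_on_empty)
  have L: "L i = M i + (\<Sum>v\<in>C i - sep C i. l v)" if "i \<in> {1..r}" for i
    unfolding L_def M_def l_def
    by (rule ln_det_chain(1)[OF \<Gamma> complete_C[OF that]]) (use parents_new[OF that] in \<open>auto simp: sep_def\<close>)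
  have p: "(\<Sum>v\<in>C i - sep C i. p v) = (c i - s i) * M i + (\<Sum>v\<in>C i - sep C i. (c i - f v) * l v)" if "i \<in> {1..r}" for i
  proof -
    have "sep C i \<subseteq> C i" by (simp add: sep_def)
    then have "real (card (C i - sep C i)) = c i - s i"
      unfolding c_def s_def by (simp add: card_Diff_subset of_nat_diff card_mono)
    moreover have "(\<Sum>v\<in>C i - sep C i. p v) = real (card (C i - sep C i)) * M i + (\<Sum>v\<in>C i - sep C i. (c i - f v) * l v)"
      unfolding M_def l_def p_def c_def f_def
      by (rule ln_det_chain(2)[OF \<Gamma> complete_C[OF that]]) (use parents_new[OF that] in \<open>auto simp: sep_def\<close>)
    ultimately show ?thesis by simp
  qed
  have summand: "(\<alpha> i - (c i + 1) / 2) * L i - (\<beta> i - (s i + 1) / 2) * M i =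
    (\<Sum>v\<in>C i - sep C i. (\<alpha> (first_index v) - (f v + 1) / 2) * l v - p v / 2) + (\<alpha> i - \<beta> i) * M i"
    if i: "i \<in> {1..r}" for i
  proof -
    define R where "R = C i - sep C i"
    have "(\<Sum>v\<in>R. (\<alpha> (first_index v) - (f v + 1) / 2) * l v - p v / 2) =
      (\<Sum>v\<in>R. (\<alpha> i - (c i + 1) / 2) * l v + (c i - f v) * l v / 2 - p v / 2)"
    proof (rule sum.cong[OF refl])
      fix v assume "v \<in> R"
      then have "first_index v = i" using first_index_eq_iff[OF i] unfolding R_def by blast
      then show "(\<alpha> (first_index v) - (f v + 1) / 2) * l v - p v / 2 =
        (\<alpha> i - (c i + 1) / 2) * l v + (c i - f v) * l v / 2 - p v / 2"
        by (simp add: field_simps)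
    qed
    also have "\<dots> = (\<alpha> i - (c i + 1) / 2) * (\<Sum>v\<in>R. l v) + (\<Sum>v\<in>R. (c i - f v) * l v) / 2 - (\<Sum>v\<in>R. p v) / 2"
      by (simp add: sum.distrib sum_subtractf sum_distrib_left sum_divide_distrib)
    also have "\<dots> = (\<alpha> i - (c i + 1) / 2) * (L i - M i) - (c i - s i) * M i / 2"
      using p[OF i] L[OF i] unfolding R_def by (simp add: field_simps)
    finally show ?thesis unfolding R_def by (simp add: field_simps)
  qed
  have anc: "(\<alpha> i - \<beta> i) * M i = (\<Sum>v\<in>UNIV. if ancestral D (sep C i) \<and> v \<in> sep C i then (\<alpha> i - \<beta> i) * l v else 0)"
    if i: "i \<in> {2..r}" for i
  proof (cases "ancestral D (sep C i)")
    case True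
    have "i \<in> {1..r}" using i by simp
    then have "complete_in E (sep C i)" by (rule complete_sep)
    moreover have "parents D v \<subseteq> sep C i" if "v \<in> sep C i" for v
      using True that unfolding ancestral_def parents_def by blast
    ultimately have "M i = (\<Sum>v\<in>sep C i. l v)"
      using ln_det_chain(1)[OF \<Gamma>, of "sep C i" "{}"] unfolding M_def l_def by (simp add: det_on_empty)
    then show ?thesis using True by (simp add: sum_distrib_left sum.If_cases)
  next
    case False
    then show ?thesis using eq[OF i] by simp
  qed
  have "(\<Sum>i=1..r. (\<alpha> i - (c i + 1) / 2) * L i) - (\<Sum>i=2..r. (\<beta> i - (s i + 1) / 2) * M i) =
    (\<Sum>i=1..r. (\<alpha> i - (c i + 1) / 2) * L i - (\<beta> i - (s i + 1) / 2) * M i)"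
    unfolding sum_subtractf r1 by (simp add: M1[unfolded One_nat_def])
  also have "\<dots> = (\<Sum>i=1..r. \<Sum>v\<in>C i - sep C i. (\<alpha> (first_index v) - (f v + 1) / 2) * l v - p v / 2) + (\<Sum>i=1..r. (\<alpha> i - \<beta> i) * M i)"
    by (simp add: summand sum.distrib[symmetric])
  also have "(\<Sum>i=1..r. \<Sum>v\<in>C i - sep C i. (\<alpha> (first_index v) - (f v + 1) / 2) * l v - p v / 2) =
    (\<Sum>i=1..r. \<Sum>v\<in>{v \<in> UNIV. first_index v = i}. (\<alpha> (first_index v) - (f v + 1) / 2) * l v - p v / 2)"
    by (rule sum.cong[OF refl]) (simp only: new_vertices)
  also have "\<dots> = (\<Sum>v\<in>UNIV. (\<alpha> (first_index v) - (f v + 1) / 2) * l v - p v / 2)"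
    by (rule sum.group) (use first_index_range in auto)
  also have "(\<Sum>i=1..r. (\<alpha> i - \<beta> i) * M i) = (\<Sum>i=2..r. (\<alpha> i - \<beta> i) * M i)"
    unfolding r1 by (simp add: M1[unfolded One_nat_def])
  also have "\<dots> = (\<Sum>i=2..r. \<Sum>v\<in>UNIV. if ancestral D (sep C i) \<and> v \<in> sep C i then (\<alpha> i - \<beta> i) * l v else 0)"
    by (rule sum.cong[OF refl]) (rule anc)
  also have "\<dots> = (\<Sum>v\<in>UNIV. \<Sum>i=2..r. if ancestral D (sep C i) \<and> v \<in> sep C i then (\<alpha> i - \<beta> i) * l v else 0)"
    by (rule sum.swap)
  also have "(\<Sum>v\<in>UNIV. (\<alpha> (first_index v) - (f v + 1) / 2) * l v - p v / 2) + \<dots> =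
    (\<Sum>v\<in>UNIV. exponent \<alpha> \<beta> v * l v + (- 1 / 2) * p v)"
    unfolding sum.distrib[symmetric]
  proof (rule sum.cong[OF refl])
    fix v
    have "(\<Sum>i=2..r. if ancestral D (sep C i) \<and> v \<in> sep C i then (\<alpha> i - \<beta> i) * l v else 0) =
      (\<Sum>i | i \<in> {2..r} \<and> ancestral D (sep C i) \<and> v \<in> sep C i. (\<alpha> i - \<beta> i) * l v)"
      by (rule sum.inter_filter[symmetric]) simp
    then show "(\<alpha> (first_index v) - (f v + 1) / 2) * l v - p v / 2 +
       (\<Sum>i=2..r. if ancestral D (sep C i) \<and> v \<in> sep C i then (\<alpha> i - \<beta> i) * l v else 0) =
      exponent \<alpha> \<beta> v * l v + (- 1 / 2) * p v"
      unfolding exponent_def f_def[symmetric] sum_distrib_right[symmetric] by (simp add: algebra_simps)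
  qed
  finally have log: "(\<Sum>i=1..r. (\<alpha> i - (c i + 1) / 2) * L i) - (\<Sum>i=2..r. (\<beta> i - (s i + 1) / 2) * M i) =
    (\<Sum>v\<in>UNIV. exponent \<alpha> \<beta> v * l v + (- 1 / 2) * p v)" .
  have merge: "(\<Sum>i\<in>I. - (y i + 1) / 2 * X i) + (\<Sum>i\<in>I. a i * X i) = (\<Sum>i\<in>I. (a i - (y i + 1) / 2) * X i)"
    for I :: "nat set" and y a X :: "nat \<Rightarrow> real"
    unfolding sum.distrib[symmetric] by (intro sum.cong refl) (simp add: field_simps)
  have "H_G r C (\<lambda>i. - (c i + 1) / 2) (\<lambda>i. - (s i + 1) / 2) \<Gamma> * H_G r C \<alpha> \<beta> \<Gamma> =
    exp ((\<Sum>i=1..r. (\<alpha> i - (c i + 1) / 2) * L i) - (\<Sum>i=2..r. (\<beta> i - (s i + 1) / 2) * M i))"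
    unfolding H_G_eq_exp[OF \<Gamma>] L_def[symmetric] M_def[symmetric] exp_add[symmetric]
    by (rule arg_cong[where f = exp]) (simp only: merge[symmetric])
  also have "\<dots> = (\<Prod>v\<in>UNIV. exp (exponent \<alpha> \<beta> v * l v) * exp ((- 1 / 2) * p v))"
    unfolding log by (simp add: exp_sum exp_add[symmetric])
  also have "\<dots> = (\<Prod>v\<in>UNIV. det_ratio v \<Gamma> powr exponent \<alpha> \<beta> v * det_on (parents D v) (edge_matrix \<Gamma>) powr (- 1 / 2))"
  proof (rule prod.cong[OF refl])
    fix v
    have "det_on (family D v) (edge_matrix \<Gamma>) > 0" "det_on (parents D v) (edge_matrix \<Gamma>) > 0"
      by (intro det_on_pos pos_def_family[OF \<Gamma>] pos_def_parents[OF \<Gamma>])+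
    then have "det_ratio v \<Gamma> \<noteq> 0" "det_on (parents D v) (edge_matrix \<Gamma>) \<noteq> 0"
      unfolding det_ratio_def by simp_all
    then show "exp (exponent \<alpha> \<beta> v * l v) * exp ((- 1 / 2) * p v) =
      det_ratio v \<Gamma> powr exponent \<alpha> \<beta> v * det_on (parents D v) (edge_matrix \<Gamma>) powr (- 1 / 2)"
      by (simp add: powr_def l_def p_def)
  qed
  finally show ?thesis unfolding c_def s_def .
qed

end

section \<open>Finiteness of the integral\<close>

text \<open>This bound holds for every \<open>f\<close>: where the right-hand side does not define a measure,
  \<^term>\<open>density M f\<close> is the zero measure. It applies to a density that contains the completion,
  which is given by a definite description.\<close>

lemma emeasure_density_le: "emeasure (density M f) A \<le> (\<integral>\<^sup>+x. f x * indicator A x \<partial>M)"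
  unfolding density_def emeasure_measure_of_conv by simp

context induced_dag
begin

lemma edges_in_UNIV: "edges_in E UNIV = E"
  unfolding edges_in_def by simp

lemma Q_G_in_sets: "Q_G E \<in> sets (\<Pi>\<^sub>M e\<in>E. (lborel :: real measure))"
proof -
  have "Measurable.pred (\<Pi>\<^sub>M e\<in>E. (lborel :: real measure)) (\<lambda>\<Gamma>. \<forall>A\<in>{A. clique E A}. pos_def_on A (edge_matrix \<Gamma>))"
    by (intro pred_intros_finite(3) pred_pos_def_on) (auto simp: clique_def complete_in_def)
  moreover have "Q_G E = {\<Gamma> \<in> space (\<Pi>\<^sub>M e\<in>E. (lborel :: real measure)). \<forall>A\<in>{A. clique E A}. pos_def_on A (edge_matrix \<Gamma>)}"
    unfolding Q_G_def by (simp add: space_PiM)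
  ultimately show ?thesis unfolding pred_def by simp
qed

lemma borel_measurable_H_G: "(\<lambda>\<Gamma>. H_G r C a b \<Gamma>) \<in> borel_measurable (\<Pi>\<^sub>M e\<in>E. lborel)"
proof -
  have C: "(\<lambda>\<Gamma>. det_on (C i) (edge_matrix \<Gamma>)) \<in> borel_measurable (\<Pi>\<^sub>M e\<in>E. lborel)" if "i \<in> {1..r}" for i
    using complete_C[OF that] by (intro borel_measurable_det_on) (simp add: complete_in_def)
  have S: "(\<lambda>\<Gamma>. det_on (sep C i) (edge_matrix \<Gamma>)) \<in> borel_measurable (\<Pi>\<^sub>M e\<in>E. lborel)" if "i \<in> {2..r}" for i
  proof -
    have "i \<in> {1..r}" using that by simp
    from complete_sep[OF this] show ?thesis
      by (intro borel_measurable_det_on) (simp add: complete_in_def)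
  qed
  show ?thesis unfolding H_G_def
    by (intro borel_measurable_divide borel_measurable_prod powr_real_measurable borel_measurable_const C S)
qed

lemma borel_measurable_energy: "energy w v \<in> borel_measurable (\<Pi>\<^sub>M e\<in>E. lborel)"
  unfolding energy_def[abs_def]
proof (intro borel_measurable_sum borel_measurable_times borel_measurable_const borel_measurable_component)
  fix i j assume "i \<in> family D v" "j \<in> family D v"
  then show "{i, j} \<in> E" using complete_family[of v] unfolding complete_in_def by blast
qed

lemma density_eq_prod_factor:
  assumes \<Gamma>: "\<Gamma> \<in> Q_G E" and U: "U \<in> Q_G E"
    and eq: "\<And>i. i \<in> {2..r} \<Longrightarrow> \<not> ancestral D (sep C i) \<Longrightarrow> \<alpha> i = \<beta> i"
  shows "ennreal (H_G r C (\<lambda>i. - (real (card (C i)) + 1) / 2) (\<lambda>i. - (real (card (sep C i)) + 1) / 2) \<Gamma>) *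
    ennreal (exp (- (\<Sum>v\<in>UNIV. 1 / cond_var U v * energy (residual U) v \<Gamma>)) * H_G r C \<alpha> \<beta> \<Gamma>) =
    (\<Prod>v\<in>UNIV. factor (\<lambda>v. 1 / cond_var U v) (residual U) (exponent \<alpha> \<beta>) v \<Gamma>)"
proof -
  define H0 where "H0 = H_G r C (\<lambda>i. - (real (card (C i)) + 1) / 2) (\<lambda>i. - (real (card (sep C i)) + 1) / 2) \<Gamma>"
  have "H0 > 0" "H_G r C \<alpha> \<beta> \<Gamma> > 0" unfolding H0_def H_G_eq_exp[OF \<Gamma>] by simp_all
  then have "ennreal H0 * ennreal (exp (- (\<Sum>v\<in>UNIV. 1 / cond_var U v * energy (residual U) v \<Gamma>)) * H_G r C \<alpha> \<beta> \<Gamma>) =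
    ennreal (exp (- (\<Sum>v\<in>UNIV. 1 / cond_var U v * energy (residual U) v \<Gamma>)) * (H0 * H_G r C \<alpha> \<beta> \<Gamma>))"
    by (simp add: ennreal_mult'[symmetric] mult_ac)
  also have "exp (- (\<Sum>v\<in>UNIV. 1 / cond_var U v * energy (residual U) v \<Gamma>)) * (H0 * H_G r C \<alpha> \<beta> \<Gamma>) =
    (\<Prod>v\<in>UNIV. exp (- (1 / cond_var U v) * energy (residual U) v \<Gamma>) * det_ratio v \<Gamma> powr exponent \<alpha> \<beta> v *
      det_on (parents D v) (edge_matrix \<Gamma>) powr (- 1 / 2))"
  proof -
    have "H0 * H_G r C \<alpha> \<beta> \<Gamma> = (\<Prod>v\<in>UNIV. det_ratio v \<Gamma> powr exponent \<alpha> \<beta> v *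
        det_on (parents D v) (edge_matrix \<Gamma>) powr (- 1 / 2))"
      unfolding H0_def by (rule H_G_factorization[OF \<Gamma> eq])
    moreover have "exp (- (\<Sum>v\<in>UNIV. 1 / cond_var U v * energy (residual U) v \<Gamma>)) =
      (\<Prod>v\<in>UNIV. exp (- (1 / cond_var U v) * energy (residual U) v \<Gamma>))"
      by (simp add: sum_negf[symmetric] exp_sum)
    ultimately show ?thesis by (simp only: prod.distrib mult.assoc)
  qed
  also have "ennreal \<dots> = (\<Prod>v\<in>UNIV. factor (\<lambda>v. 1 / cond_var U v) (residual U) (exponent \<alpha> \<beta>) v \<Gamma>)"
    unfolding factor_def using pos_def_family[OF \<Gamma>] by (simp add: prod_ennreal)
  finally show ?thesis unfolding H0_def .
qed

lemma emeasure_omega_Q_finite: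
  assumes U: "U \<in> Q_G E"
    and eq: "\<And>i. i \<in> {2..r} \<Longrightarrow> \<not> ancestral D (sep C i) \<Longrightarrow> \<alpha> i = \<beta> i"
    and e: "\<And>v. exponent \<alpha> \<beta> v > -1"
  shows "emeasure (omega_Q E r C \<alpha> \<beta> U) (Q_G E) < \<infinity>"
proof -
  define B where "B = (\<Pi>\<^sub>M e\<in>E. (lborel :: real measure))"
  define H0 where "H0 \<Gamma> = ennreal (H_G r C (\<lambda>i. - (real (card (C i)) + 1) / 2) (\<lambda>i. - (real (card (sep C i)) + 1) / 2) \<Gamma>)" for \<Gamma>
  define G where "G \<Gamma> = ennreal (exp (- (\<Sum>v\<in>UNIV. 1 / cond_var U v * energy (residual U) v \<Gamma>)) * H_G r C \<alpha> \<beta> \<Gamma>)" for \<Gamma>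
  define F where "F \<Gamma> = (\<Prod>v\<in>UNIV. factor (\<lambda>v. 1 / cond_var U v) (residual U) (exponent \<alpha> \<beta>) v \<Gamma>)" for \<Gamma>
  have QB: "Q_G E \<in> sets B" unfolding B_def by (rule Q_G_in_sets)
  have QS: "Q_G E \<subseteq> space B" using sets.sets_into_space[OF QB] .
  have mu: "mu_G E r C = density (restrict_space B (Q_G E)) H0"
    unfolding mu_G_def lebesgue_Q_def B_def H0_def ..
  have space_mu: "space (mu_G E r C) = Q_G E" unfolding mu using QS by (auto simp: space_restrict_space)
  have H0m: "H0 \<in> borel_measurable B"
    unfolding H0_def[abs_def] B_def by (intro measurable_compose[OF borel_measurable_H_G measurable_ennreal])
  have Gm: "G \<in> borel_measurable B"
  proof -
    have [measurable]: "(\<lambda>\<Gamma>. \<Sum>v\<in>UNIV. 1 / cond_var U v * energy (residual U) v \<Gamma>) \<in> borel_measurable B"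
      unfolding B_def
      by (intro borel_measurable_times borel_measurable_sum borel_measurable_const borel_measurable_energy)
    have [measurable]: "(\<lambda>\<Gamma>. H_G r C \<alpha> \<beta> \<Gamma>) \<in> borel_measurable B"
      unfolding B_def by (rule borel_measurable_H_G)
    show ?thesis unfolding G_def[abs_def] by measurable
  qed
  have "emeasure (omega_Q E r C \<alpha> \<beta> U) (Q_G E) \<le> (\<integral>\<^sup>+\<Gamma>. ennreal (exp (- trace (completion E \<Gamma> ** matrix_inv (completion E U))) * H_G r C \<alpha> \<beta> \<Gamma>) * indicator (Q_G E) \<Gamma> \<partial>mu_G E r C)"
    unfolding omega_Q_def by (rule emeasure_density_le)
  also have "\<dots> = (\<integral>\<^sup>+\<Gamma>. G \<Gamma> \<partial>mu_G E r C)"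
    by (rule nn_integral_cong) (simp add: space_mu G_def trace_completion[OF _ U] energy_def)
  also have "\<dots> = (\<integral>\<^sup>+\<Gamma>. H0 \<Gamma> * G \<Gamma> \<partial>restrict_space B (Q_G E))"
    unfolding mu using H0m Gm by (intro nn_integral_density measurable_restrict_space1)
  also have "\<dots> = (\<integral>\<^sup>+\<Gamma>. H0 \<Gamma> * G \<Gamma> * indicator (Q_G E) \<Gamma> \<partial>B)"
    by (rule nn_integral_restrict_space) (use QB QS in \<open>simp add: Int_absorb2\<close>)
  also have "\<dots> \<le> (\<integral>\<^sup>+\<Gamma>. F \<Gamma> \<partial>B)"
  proof (rule nn_integral_mono)
    fix \<Gamma>
    show "H0 \<Gamma> * G \<Gamma> * indicator (Q_G E) \<Gamma> \<le> F \<Gamma>"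
    proof (cases "\<Gamma> \<in> Q_G E")
      case True
      then have "H0 \<Gamma> * G \<Gamma> = F \<Gamma>"
        unfolding H0_def G_def F_def by (rule density_eq_prod_factor[OF _ U eq])
      then show ?thesis using True by simp
    qed simp
  qed
  also have "\<dots> < \<infinity>"
  proof -
    have "(\<integral>\<^sup>+\<Gamma>. F \<Gamma> \<partial>(\<Pi>\<^sub>M e\<in>edges_in E UNIV. lborel)) < \<infinity>"
      unfolding F_def
      by (rule nn_integral_prod_factor_finite) (use cond_var_pos[OF U] e in \<open>simp_all add: residual_def\<close>)
    then show ?thesis unfolding edges_in_UNIV B_def .
  qed
  finally show ?thesis .
qed

end

section \<open>The submanifold of parameters\<close>

lemma smooth_on_ident: "smooth_on S (\<lambda>x. x)"
proof -
  have const: "Ck_on k S (\<lambda>_. c)" for k and c :: 'a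
    by (induction k arbitrary: c) (simp_all add: frechet_derivative_const)
  have "Ck_on k S (\<lambda>x. x)" for k
    by (cases k) (simp_all add: const)
  then show ?thesis unfolding smooth_on_def by blast
qed

text \<open>Relatively open subsets of subspaces are straight already: the identity is a chart around
  every point.\<close>

lemma submanifold_subspace_Int_open:
  fixes L W :: "'a::euclidean_space set"
  assumes "subspace L" "open W" "L \<inter> W \<noteq> {}"
  shows "submanifold (dim L) (L \<inter> W)"
  unfolding submanifold_def
proof (intro conjI ballI)
  fix x assume x: "x \<in> L \<inter> W"
  have hom: "homeomorphism W W (\<lambda>x. x) (\<lambda>x. x)" by (simp add: homeomorphism_def)
  show "\<exists>V W' (\<phi> :: 'a \<Rightarrow> 'a) \<psi> L'. open V \<and> x \<in> V \<and> open W' \<and> homeomorphism V W' \<phi> \<psi> \<and> smooth_on V \<phi> \<and>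
      smooth_on W' \<psi> \<and> subspace L' \<and> dim L' = dim L \<and> \<phi> ` (L \<inter> W \<inter> V) = L' \<inter> W'"
    by (rule exI[of _ W], rule exI[of _ W], rule exI[of _ "\<lambda>x::'a. x"], rule exI[of _ "\<lambda>x::'a. x"],
        rule exI[of _ L]) (use x hom assms smooth_on_ident in auto)
qed (rule assms(3))

text \<open>The common kernel is the orthogonal complement of a span of dimension at most \<^term>\<open>card N\<close>.\<close>

lemma dim_common_kernel_ge:
  fixes b :: "'i \<Rightarrow> 'a::euclidean_space"
  assumes "finite N"
  shows "dim {x. \<forall>i\<in>N. b i \<bullet> x = 0} + card N \<ge> DIM('a)"
proof -
  define A where "A = span (b ` N)"
  have "dim {y \<in> UNIV. \<forall>x\<in>A. orthogonal x y} + dim A = dim (UNIV :: 'a set)"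
    by (rule dim_subspace_orthogonal_to_vectors) (simp_all add: A_def)
  moreover have "dim A \<le> card N"
  proof -
    have "dim A \<le> card (b ` N)" unfolding A_def using assms by (simp add: dim_le_card')
    also have "\<dots> \<le> card N" by (rule card_image_le[OF assms])
    finally show ?thesis .
  qed
  moreover have "dim {y \<in> UNIV. \<forall>x\<in>A. orthogonal x y} \<le> dim {x. \<forall>i\<in>N. b i \<bullet> x = 0}"
    by (rule dim_subset) (auto simp: A_def orthogonal_def intro: span_base)
  ultimately show ?thesis by simp
qed

theorem proposition8p1:
  fixes E :: "'v::finite set set"
    and r :: nat
    and C :: "nat \<Rightarrow> 'v set"
    and D :: "'v rel"
    and \<iota> :: "nat \<Rightarrow> 'a::finite"
    and \<kappa> :: "nat \<Rightarrow> 'b::finite"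
  assumes "decomposable E"
    and "\<not> complete_in E UNIV"
    and "perfect_order E r C"
    and "dag_version E D"
    and "induced_by D r C"
    and "ancestral D (sep C 2)"
    \<comment> \<open>\<open>\<iota>\<close> and \<open>\<kappa>\<close> number the coordinates of \<open>real ^ 'a\<close> by \<open>1, \<dots>, r\<close> and those of \<open>real ^ 'b\<close> by
       \<open>2, \<dots>, r\<close>; thus \<open>real ^ 'a \<times> real ^ 'b\<close> is \<open>\<real>\<^sup>r \<times> \<real>\<^sup>r\<^sup>-\<^sup>1\<close>.\<close>
    and "bij_betw \<iota> {1..r} UNIV"
    and "bij_betw \<kappa> {2..r} UNIV"
  shows "\<exists>d M. d \<ge> r + num_ancestral_seps D r C \<and> submanifold d M \<and>
     M \<subseteq> {(\<alpha> :: real ^ 'a, \<beta> :: real ^ 'b). \<forall>U\<in>Q_G E.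
       emeasure (omega_Q E r C (\<lambda>i. \<alpha> $ \<iota> i) (\<lambda>i. \<beta> $ \<kappa> i) U) (Q_G E) < \<infinity>}"
proof -
  interpret induced_dag E r C D
    using assms by unfold_locales (simp_all add: decomposable_def)
  define N where "N = {i \<in> {2..r}. \<not> ancestral D (sep C i)}"
  define b :: "nat \<Rightarrow> (real ^ 'a) \<times> (real ^ 'b)" where "b i = (axis (\<iota> i) 1, - axis (\<kappa> i) 1)" for i
  define L where "L = {x. \<forall>i\<in>N. b i \<bullet> x = 0}"
  define W where "W = {x :: (real ^ 'a) \<times> (real ^ 'b).
    \<forall>v. exponent (\<lambda>i. fst x $ \<iota> i) (\<lambda>i. snd x $ \<kappa> i) v > -1}"
  have L_iff: "x \<in> L \<longleftrightarrow> (\<forall>i\<in>N. fst x $ \<iota> i = snd x $ \<kappa> i)" for x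
    unfolding L_def b_def by (cases x) (simp add: inner_axis')
  have "subspace L" unfolding L_def subspace_def by (simp add: inner_add_right)
  have "open W"
  proof -
    have "W = (\<Inter>v. {x. exponent (\<lambda>i. fst x $ \<iota> i) (\<lambda>i. snd x $ \<kappa> i) v > -1})"
      unfolding W_def by blast
    moreover have "open {x :: (real ^ 'a) \<times> (real ^ 'b). exponent (\<lambda>i. fst x $ \<iota> i) (\<lambda>i. snd x $ \<kappa> i) v > -1}" for v
      unfolding exponent_def by (intro open_Collect_less continuous_intros)
    ultimately show ?thesis by (simp add: open_INT)
  qed
  have "L \<inter> W \<noteq> {}"
  proof -
    \<comment> \<open>If all parameters are equal to a large number, the differences \<open>\<alpha>\<^sub>i - \<beta>\<^sub>i\<close> vanish.\<close>
    define x :: "(real ^ 'a) \<times> (real ^ 'b)" where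
      "x = ((\<chi> i. real CARD('v) + 1), (\<chi> i. real CARD('v) + 1))"
    have "exponent (\<lambda>i. fst x $ \<iota> i) (\<lambda>i. snd x $ \<kappa> i) v > -1" for v
    proof -
      have "card (family D v) \<le> CARD('v)" by (rule card_mono) simp_all
      then have "real (card (family D v)) \<le> real CARD('v)" by simp
      then show ?thesis unfolding exponent_def x_def by (simp add: field_simps)
    qed
    then have "x \<in> W" unfolding W_def by simp
    moreover have "x \<in> L" unfolding L_iff x_def by simp
    ultimately show ?thesis by blast
  qed
  have "dim L \<ge> r + num_ancestral_seps D r C"
  proof -
    have card: "CARD('a) = r" "CARD('b) = r - 1"
      using bij_betw_same_card[OF assms(7)] bij_betw_same_card[OF assms(8)] by simp_all
    have "dim L + card N \<ge> r + (r - 1)"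
      using dim_common_kernel_ge[of N b] card unfolding L_def by (simp add: N_def)
    moreover have "card N + card {i \<in> {2..r}. ancestral D (sep C i)} = r - 1"
    proof -
      have "N \<union> {i \<in> {2..r}. ancestral D (sep C i)} = {2..r}" unfolding N_def by blast
      moreover have "card (N \<union> {i \<in> {2..r}. ancestral D (sep C i)}) = card N + card {i \<in> {2..r}. ancestral D (sep C i)}"
        unfolding N_def by (intro card_Un_disjoint) auto
      ultimately show ?thesis by simp
    qed
    moreover have "num_ancestral_seps D r C \<le> card {i \<in> {2..r}. ancestral D (sep C i)}"
    proof -
      have "{A \<in> sep C ` {2..r}. ancestral D A} = sep C ` {i \<in> {2..r}. ancestral D (sep C i)}" by blast
      then show ?thesis unfolding num_ancestral_seps_def by (simp add: card_image_le)
    qed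
    ultimately show ?thesis by linarith
  qed
  moreover have "submanifold (dim L) (L \<inter> W)"
    by (rule submanifold_subspace_Int_open) fact+
  moreover have "L \<inter> W \<subseteq> {(\<alpha> :: real ^ 'a, \<beta> :: real ^ 'b). \<forall>U\<in>Q_G E.
       emeasure (omega_Q E r C (\<lambda>i. \<alpha> $ \<iota> i) (\<lambda>i. \<beta> $ \<kappa> i) U) (Q_G E) < \<infinity>}"
  proof clarify
    fix \<alpha> :: "real ^ 'a" and \<beta> :: "real ^ 'b" and U
    assume x: "(\<alpha>, \<beta>) \<in> L" "(\<alpha>, \<beta>) \<in> W" and U: "U \<in> Q_G E"
    show "emeasure (omega_Q E r C (\<lambda>i. \<alpha> $ \<iota> i) (\<lambda>i. \<beta> $ \<kappa> i) U) (Q_G E) < \<infinity>"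
    proof (rule emeasure_omega_Q_finite[OF U])
      show "\<alpha> $ \<iota> i = \<beta> $ \<kappa> i" if "i \<in> {2..r}" "\<not> ancestral D (sep C i)" for i
        using x(1) that unfolding L_iff N_def by simp
      show "exponent (\<lambda>i. \<alpha> $ \<iota> i) (\<lambda>i. \<beta> $ \<kappa> i) v > -1" for v
        using x(2) unfolding W_def by simp
    qed
  qed
  ultimately show ?thesis by (intro exI[of _ "dim L"] exI[of _ "L \<inter> W"]) blast
qed

end
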